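(* Let $n\ge 1$ be an integer and let $T$ be a tree. Then $$\Upsilon_{h^{(n)}}(T)=\left\lceil\frac{\Upsilon_{h^{(n-1)\perp}}(T)}{n}\right\rceil .$$
   Context: All graphs are finite and simple. An $m$-cube is an $m$-dimensional (closed) unit hypercube; $\mathbf e_1,\mathbf e_2,\dots$ denote standard basis vectors. A graph $G$ is an $n$-cube visibility graph if its vertices can be assigned to pairwise disjoint axis-aligned unit $n$-cubes in $\mathbb{R}^n$ (one cube per vertex) such that two vertices are adjacent if and only if there is an uninterrupted axis-aligned cylindrical channel of positive diameter (parallel to some $\mathbf e_i$, $1\le i\le n$) between their cubes; uninterrupted means that it intersects none of the other cubes. A graph $G$ is an $m$-cube orthogonal visibility graph if its vertices can be assigned to pairwise disjoint unit $m$-cubes in $\mathbb{R}^{m+1}$ aligned with the first $m$ axes, i.e. sets of the form $\prod_{i=1}^m[a_i,a_i+1]\times\{c\}$ (one per vertex), such that two vertices are adjacent if and only if there is a cylindrical channel of positive diameter parallel to $\mathbf e_{m+1}$ between their cubes that intersects none of the other cubes. (For $m=0$ the objects are distinct points of $\mathbb{R}$, and two points see each other when no other point of the representation lies strictly between them.) An $n$-cube visibility forest (resp. $m$-cube orthogonal visibility forest) is a disjoint union of trees each of which is an $n$-cube visibility graph (resp. $m$-cube orthogonal visibility graph). For a graph $G$, $\Upsilon_{h^{(n)}}(G)$ is the minimum $k$ such that $G$ is the union of $k$ subgraphs each of which is an $n$-cube visibility forest, and $\Upsilon_{h^{(m)\perp}}(G)$ is the minimum $k$ such that $G$ is the union of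 $k$ subgraphs each of which is an $m$-cube orthogonal visibility forest. *)

theory Defs
  imports "HOL-Analysis.L2_Norm" "HOL-Library.Disjoint_Sets" "Graph_Theory.Graph_Theory"
begin

text \<open>A finite simple graph is a value of type \<^typ>\<open>'a pair_pre_digraph\<close> satisfying
  \<^locale>\<open>pair_graph\<close>: a finite, loop-free digraph with a symmetric arc set, each edge being
  represented by its two opposite arcs. The library's \<open>tree\<close> is not usable here, since the two
  opposite arcs of an edge form a cycle in the sense of \<open>pre_digraph.cycle\<close>; only the cycles of
  length at least 3 are cycles of the undirected graph.\<close>

definition simple_tree :: "'a pair_pre_digraph \<Rightarrow> bool" where
  "simple_tree G \<longleftrightarrow> pair_graph G \<and> Digraph_Component.connected (with_proj G) \<and>
     \<not> (\<exists>p. pre_digraph.cycle (with_proj G) p \<and> 3 \<le> length p)"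

text \<open>Points of \<open>\<real>\<^sup>d\<close> are the functions in \<^term>\<open>extensional {..<d} :: (nat \<Rightarrow> real) set\<close>;
  the coordinate directions are numbered from 0 to \<open>d - 1\<close>.\<close>

definition unit_cube :: "nat \<Rightarrow> (nat \<Rightarrow> real) \<Rightarrow> (nat \<Rightarrow> real) set" where
  "unit_cube n a = (\<Pi>\<^sub>E i\<in>{..<n}. {a i..a i + 1})"

text \<open>The unit \<open>m\<close>-cube in \<open>\<real>\<^bsup>m+1\<^esup>\<close> orthogonal to the last axis; the height is
  \<^term>\<open>a m\<close>.\<close>

definition orthogonal_unit_cube :: "nat \<Rightarrow> (nat \<Rightarrow> real) \<Rightarrow> (nat \<Rightarrow> real) set" where
  "orthogonal_unit_cube m a = (\<Pi>\<^sub>E i\<in>{..<Suc m}. if i < m then {a i..a i + 1} else {a m})"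

text \<open>The closed \<open>(d - 1)\<close>-dimensional disc of radius \<open>r\<close> orthogonal to direction \<open>i\<close>, at height
  \<open>h\<close> in direction \<open>i\<close>, whose centre has the coordinates \<open>p j\<close> (\<open>j \<noteq> i\<close>). For \<open>d = 1\<close> this is
  a single point, so that a channel on the line is just a segment.\<close>

definition disc :: "nat \<Rightarrow> nat \<Rightarrow> (nat \<Rightarrow> real) \<Rightarrow> real \<Rightarrow> real \<Rightarrow> (nat \<Rightarrow> real) set" where
  "disc d i p r h =
     {x \<in> extensional {..<d}. L2_set (\<lambda>j. x j - p j) ({..<d} - {i}) \<le> r \<and> x i = h}"

definition channel ::
    "nat \<Rightarrow> nat \<Rightarrow> (nat \<Rightarrow> real) \<Rightarrow> real \<Rightarrow> real \<Rightarrow> real \<Rightarrow> (nat \<Rightarrow> real) set" where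
  "channel d i p r s t = (\<Union>h\<in>{min s t..max s t}. disc d i p r h)"

text \<open>In the family of subsets \<open>C w\<close> (\<open>w \<in> V\<close>) of \<open>\<real>\<^sup>d\<close>, an uninterrupted channel parallel to
  direction \<open>i\<close> joins \<open>C u\<close> to \<open>C v\<close>: its two end discs lie in \<open>C u\<close> and \<open>C v\<close>.\<close>

definition sees ::
    "nat \<Rightarrow> nat \<Rightarrow> ('a \<Rightarrow> (nat \<Rightarrow> real) set) \<Rightarrow> 'a set \<Rightarrow> 'a \<Rightarrow> 'a \<Rightarrow> bool" where
  "sees d i C V u v \<longleftrightarrow> (\<exists>p r s t. 0 < r \<and> disc d i p r s \<subseteq> C u \<and> disc d i p r t \<subseteq> C v \<and>
     (\<forall>w\<in>V - {u, v}. channel d i p r s t \<inter> C w = {}))"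

definition visibility_representation ::
    "nat \<Rightarrow> nat set \<Rightarrow> ('a \<Rightarrow> (nat \<Rightarrow> real) set) \<Rightarrow> 'a pair_pre_digraph \<Rightarrow> bool" where
  "visibility_representation d I C G \<longleftrightarrow> disjoint_family_on C (pverts G) \<and>
     (\<forall>u\<in>pverts G. \<forall>v\<in>pverts G.
        (u, v) \<in> parcs G \<longleftrightarrow> u \<noteq> v \<and> (\<exists>i\<in>I. sees d i C (pverts G) u v))"

definition cube_visibility_graph :: "nat \<Rightarrow> 'a pair_pre_digraph \<Rightarrow> bool" where
  "cube_visibility_graph n G \<longleftrightarrow> pair_graph G \<and>
     (\<exists>a. visibility_representation n {..<n} (\<lambda>v. unit_cube n (a v)) G)"

definition orthogonal_visibility_graph :: "nat \<Rightarrow> 'a pair_pre_digraph \<Rightarrow> bool" where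
  "orthogonal_visibility_graph m G \<longleftrightarrow> pair_graph G \<and>
     (\<exists>a. visibility_representation (Suc m) {m} (\<lambda>v. orthogonal_unit_cube m (a v)) G)"

definition disjoint_union_of_trees ::
    "('a pair_pre_digraph \<Rightarrow> bool) \<Rightarrow> 'a pair_pre_digraph \<Rightarrow> bool" where
  "disjoint_union_of_trees P F \<longleftrightarrow> pair_graph F \<and>
     (\<exists>\<T>. (\<forall>S\<in>\<T>. simple_tree S \<and> P S) \<and> disjoint_family_on pverts \<T> \<and>
        pverts F = (\<Union>S\<in>\<T>. pverts S) \<and> parcs F = (\<Union>S\<in>\<T>. parcs S))"

definition cube_visibility_forest :: "nat \<Rightarrow> 'a pair_pre_digraph \<Rightarrow> bool" where
  "cube_visibility_forest n = disjoint_union_of_trees (cube_visibility_graph n)"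

definition orthogonal_visibility_forest :: "nat \<Rightarrow> 'a pair_pre_digraph \<Rightarrow> bool" where
  "orthogonal_visibility_forest m = disjoint_union_of_trees (orthogonal_visibility_graph m)"

definition union_of_subgraphs ::
    "('a pair_pre_digraph \<Rightarrow> bool) \<Rightarrow> nat \<Rightarrow> 'a pair_pre_digraph \<Rightarrow> bool" where
  "union_of_subgraphs Q k G \<longleftrightarrow>
     (\<exists>H. (\<forall>j<k. subgraph (with_proj (H j)) (with_proj G) \<and> Q (H j)) \<and>
        pverts G = (\<Union>j<k. pverts (H j)) \<and> parcs G = (\<Union>j<k. parcs (H j)))"

text \<open>The minima below are over nonempty sets for every finite simple graph (in the first case for
  \<open>n \<ge> 1\<close>): single vertices and single edges are visibility graphs.\<close>

definition Upsilon_cube :: "nat \<Rightarrow> 'a pair_pre_digraph \<Rightarrow> nat" where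
  "Upsilon_cube n G = (LEAST k. union_of_subgraphs (cube_visibility_forest n) k G)"

definition Upsilon_orthogonal :: "nat \<Rightarrow> 'a pair_pre_digraph \<Rightarrow> nat" where
  "Upsilon_orthogonal m G = (LEAST k. union_of_subgraphs (orthogonal_visibility_forest m) k G)"

end

theory Submission
  imports Defs "HOL-Combinatorics.Transposition"
begin

text \<open>Projecting the cubes of an \<open>n\<close>-cube representation along direction \<open>i\<close> turns the arcs seen in
  that direction into an orthogonal visibility graph. The components of this graph are again
  orthogonal visibility trees, because a generic line of sight inside a channel passes through a chain of
  consecutively visible cubes, and in a forest such a chain cannot be hidden from a connected part
  that contains its ends. Hence one cube visibility forest is the union of \<open>n\<close> orthogonal ones.

  Conversely, let the arcs of a tree be coloured with the \<open>n\<close> directions so that every monochromatic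
  component is an orthogonal visibility tree. Place the cubes one leaf at a time: a new leaf joined in
  colour \<open>i\<close> copies the offsets of its orthogonal representation in the coordinates other than \<open>i\<close>, and
  its coordinate \<open>i\<close> is put far from all earlier ones, at the right height within its component.
  Then cubes that do not share a component of colour \<open>i\<close> are far apart in some coordinate other than
  \<open>i\<close>, so they neither see nor block each other in direction \<open>i\<close>.\<close>

section \<open>Trees and components\<close>

text \<open>Deleting cubes can delete blockers and so create sightings; the remaining cubes need not
  represent the induced subgraph. Acyclicity secures heredity for connected parts, and both
  directions rely on it: in the converse the given forests may share arcs while each arc gets one
  colour, so a monochromatic component can be a proper part of the orthogonal tree it comes from.

  The converse faces a conflict: coordinate \<open>j\<close> is the height for direction
  \<open>j\<close> and an offset for every other direction. Two freedoms resolve it. Visibility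
  depends on heights only through their order, so heights can be stretched, and on offsets only up
  to a common translation of a component. A new leaf is isolated in all colours but one, so one
  colour prescribes its offsets, and the coordinate left over is its height there and its separation
  in all other colours. Inserting a height between old ones consumes room, hence gaps must be
  demanded in advance, larger the more leaves are still to come.

  Since \<open>n\<close> orthogonal forests make one cube forest and conversely, the cube number is
  the least \<open>k\<close> with \<open>k * n\<close> at least the orthogonal number.\<close>

lemma pair_graph_iff:
  "pair_graph G \<longleftrightarrow>
     finite (pverts G) \<and> parcs G \<subseteq> pverts G \<times> pverts G \<and> sym (parcs G) \<and> irrefl (parcs G)"
proof
  assume "pair_graph G"
  then interpret pair_graph G .
  show "finite (pverts G) \<and> parcs G \<subseteq> pverts G \<times> pverts G \<and> sym (parcs G) \<and> irrefl (parcs G)"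
    using finite_verts sym_arcs no_loops arc_fst_in_verts arc_snd_in_verts
    by (force simp: symmetric_def irrefl_def)
next
  assume *: "finite (pverts G) \<and> parcs G \<subseteq> pverts G \<times> pverts G \<and> sym (parcs G) \<and> irrefl (parcs G)"
  then have "finite (parcs G)"
    by (meson finite_SigmaI finite_subset)
  with * show "pair_graph G"
    by unfold_locales (auto simp: symmetric_def irrefl_def)
qed

lemma connected_iff_rtrancl:
  assumes "pair_graph G"
  shows "Digraph_Component.connected (with_proj G) \<longleftrightarrow>
    pverts G \<noteq> {} \<and> (\<forall>u\<in>pverts G. \<forall>v\<in>pverts G. (u, v) \<in> (parcs G)\<^sup>*)"
proof -
  interpret pair_graph G by fact
  have sub: "parcs G \<inter> pverts G \<times> pverts G = parcs G"
    using assms by (auto simp: pair_graph_iff)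
  have "Digraph_Component.connected (with_proj G) \<longleftrightarrow> strongly_connected (with_proj G)"
    unfolding connected_def strongly_connected_def
    using reachable_mk_symmetric_eq sym_arcs by auto
  then show ?thesis
    unfolding strongly_connected_def using reachable_conv sub by auto
qed

text \<open>Every arc is the only connection between its ends; for arc sets of finite simple graphs this says that
  there are no cycles.\<close>

definition bridging :: "('a \<times> 'a) set \<Rightarrow> bool" where
  "bridging E \<longleftrightarrow> (\<forall>A u v. A \<subseteq> E \<longrightarrow> (u, v) \<in> E \<longrightarrow> (u, v) \<in> A\<^sup>* \<longrightarrow> (u, v) \<in> A)"

lemma bridgingD: "bridging E \<Longrightarrow> (u, v) \<in> E \<Longrightarrow> A \<subseteq> E \<Longrightarrow> (u, v) \<in> A\<^sup>* \<Longrightarrow> (u, v) \<in> A"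
  unfolding bridging_def by blast

lemma bridging_subset: "bridging E \<Longrightarrow> F \<subseteq> E \<Longrightarrow> bridging F"
  unfolding bridging_def by (meson subset_eq subset_trans)

text \<open>A path in \<open>A\<close> from \<open>u\<close> to \<open>v\<close> is nonempty as
  \<open>u \<noteq> v\<close>, and it is not the single missing arc, so it has at least two arcs;
  closing it with \<open>(v, u)\<close> gives a forbidden cycle. \<open>A\<close> may be any set of
  arcs, symmetric or not.\<close>

lemma simple_tree_bridging:
  assumes "simple_tree T"
  shows "bridging (parcs T)"
proof (unfold bridging_def, intro allI impI, rule ccontr)
  fix A u v assume A: "A \<subseteq> parcs T" and e: "(u, v) \<in> parcs T" and r: "(u, v) \<in> A\<^sup>*" and n: "(u, v) \<notin> A"
  have pg: "pair_graph T" and ac: "\<not> (\<exists>p. pre_digraph.cycle (with_proj T) p \<and> 3 \<le> length p)"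
    using assms by (auto simp: simple_tree_def)
  interpret T: pair_graph T by fact
  have uv: "u \<in> pverts T" "v \<in> pverts T" "u \<noteq> v" "(v, u) \<in> parcs T"
    using pg e by (auto simp: pair_graph_iff irrefl_def dest: symD)
  let ?G = "\<lparr>pverts = pverts T, parcs = A\<rparr>"
  interpret A: pair_wf_digraph ?G
    using A pg by unfold_locales (auto simp: pair_graph_iff)
  have "A \<inter> pverts T \<times> pverts T = A" using A pg by (auto simp: pair_graph_iff)
  with r uv have "u \<rightarrow>\<^sup>*\<^bsub>with_proj ?G\<^esub> v"
    using A.reachable_conv[of u v] by simp
  then obtain p where "A.apath u p v" using A.reachable_apath by blast
  then have p: "set p \<subseteq> A" "pcas u p v" "distinct (pawalk_verts u p)"
    by (auto simp: A.apath_def A.awalk_def)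
  have "p \<noteq> []" using p uv by auto
  moreover have "length p \<noteq> 1"
  proof
    assume "length p = 1"
    then obtain e where "p = [e]" by (cases p) auto
    then show False using p n by (cases e) auto
  qed
  ultimately have len: "3 \<le> length (p @ [(v, u)])" by (cases p) (auto simp: Suc_le_eq)
  have vs: "pawalk_verts a (q @ [(b, c)]) = pawalk_verts a q @ [c]" if "pcas a q b" for a b c q
    using that by (induct q arbitrary: a) auto
  have cs: "pcas a (q @ [(b, c)]) c" if "pcas a q b" for a b c q
    using that by (induct q arbitrary: a) auto
  have "\<exists>vs. pawalk_verts u p = u # vs" using p(2) by (cases p) auto
  then obtain vs where "pawalk_verts u p = u # vs" by blast
  then have "distinct (tl (pawalk_verts u (p @ [(v, u)])))"
    using p vs[OF p(2)] by auto
  moreover have "T.awalk u (p @ [(v, u)]) u"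
    using p uv A cs[OF p(2)] by (auto simp: T.awalk_def)
  ultimately have "T.cycle (p @ [(v, u)])"
    unfolding T.cycle_def by auto
  with len ac show False by blast
qed

lemma pair_graph_subgraph_iff:
  assumes "pair_graph T" "pair_graph S"
  shows "subgraph (with_proj S) (with_proj T) \<longleftrightarrow> pverts S \<subseteq> pverts T \<and> parcs S \<subseteq> parcs T"
proof -
  interpret T: pair_graph T by fact
  interpret S: pair_graph S by fact
  show ?thesis
    unfolding subgraph_def compatible_def
    using T.wf_digraph S.wf_digraph by auto
qed

lemma simple_tree_connected_subgraph:
  assumes "simple_tree T" "pair_graph S" "pverts S \<subseteq> pverts T" "parcs S \<subseteq> parcs T" "pverts S \<noteq> {}"
    and "\<And>u v. u \<in> pverts S \<Longrightarrow> v \<in> pverts S \<Longrightarrow> (u, v) \<in> (parcs S)\<^sup>*"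
  shows "simple_tree S"
proof -
  have "\<not> (pre_digraph.cycle (with_proj S) p \<and> 3 \<le> length p)" for p
  proof
    assume "pre_digraph.cycle (with_proj S) p \<and> 3 \<le> length p"
    then have "pre_digraph.cycle (with_proj T) p \<and> 3 \<le> length p"
      using assms(3,4)
      by (fastforce simp: pre_digraph.cycle_def pre_digraph.awalk_def cas_with_proj_eq awalk_verts_with_proj_eq)
    then show False using assms(1) unfolding simple_tree_def by blast
  qed
  then show ?thesis
    using assms unfolding simple_tree_def by (simp add: connected_iff_rtrancl)
qed

section \<open>Connected components\<close>

definition component :: "'a pair_pre_digraph \<Rightarrow> 'a \<Rightarrow> 'a pair_pre_digraph" where
  "component G v = (let A = (parcs G)\<^sup>* `` {v} in \<lparr>pverts = A, parcs = parcs G \<inter> A \<times> A\<rparr>)"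

lemma pverts_component: "pverts (component G v) = (parcs G)\<^sup>* `` {v}"
  and parcs_component:
    "parcs (component G v) = parcs G \<inter> ((parcs G)\<^sup>* `` {v}) \<times> ((parcs G)\<^sup>* `` {v})"
  by (auto simp: component_def Let_def)

lemma rtrancl_in_field:
  assumes "(u, v) \<in> E\<^sup>*" "E \<subseteq> V \<times> V" "u \<in> V"
  shows "v \<in> V"
  using assms by (induct rule: rtrancl_induct) auto

lemma rtrancl_within_class:
  assumes "(u, v) \<in> E\<^sup>*"
  shows "(u, v) \<in> (E \<inter> (E\<^sup>* `` {u}) \<times> (E\<^sup>* `` {u}))\<^sup>*"
  using assms
proof (induct rule: rtrancl_induct)
  case (step y z)
  then have "(y, z) \<in> E \<inter> (E\<^sup>* `` {u}) \<times> (E\<^sup>* `` {u})"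
    by (auto intro: rtrancl_into_rtrancl)
  with step show ?case by (blast intro: rtrancl_into_rtrancl)
qed auto

lemma component_connected:
  assumes "sym (parcs G)" "u \<in> pverts (component G x)" "v \<in> pverts (component G x)"
  shows "(u, v) \<in> (parcs (component G x))\<^sup>*"
proof -
  have "sym (parcs (component G x))"
    using assms(1) by (auto simp: parcs_component sym_def)
  then have "sym ((parcs (component G x))\<^sup>*)" by (rule sym_rtrancl)
  moreover have "(x, u) \<in> (parcs (component G x))\<^sup>*" "(x, v) \<in> (parcs (component G x))\<^sup>*"
    using assms(2,3) rtrancl_within_class[of x _ "parcs G"] by (auto simp: pverts_component parcs_component)
  ultimately show ?thesis by (meson rtrancl_trans symD)
qed

lemma component_pair_graph:
  assumes "pair_graph G" "v \<in> pverts G"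
  shows "pair_graph (component G v)" "pverts (component G v) \<subseteq> pverts G"
    "v \<in> pverts (component G v)"
proof -
  show *: "pverts (component G v) \<subseteq> pverts G"
    using assms rtrancl_in_field[of v _ "parcs G" "pverts G"] by (auto simp: pverts_component pair_graph_iff)
  show "pair_graph (component G v)"
    using assms(1) finite_subset[OF *]
    by (auto simp: pair_graph_iff pverts_component parcs_component sym_def irrefl_def)
qed (simp add: pverts_component)

text \<open>Components inside a tree are again trees, so a forest claim reduces to the property
  \<open>P\<close> of single components. Forests are recognised this way in both directions of the
  theorem.\<close>

lemma disjoint_union_of_components:
  assumes T: "simple_tree T" and G: "pair_graph G" "pverts G \<subseteq> pverts T" "parcs G \<subseteq> parcs T"
    and P: "\<And>v. v \<in> pverts G \<Longrightarrow> P (component G v)"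
  shows "disjoint_union_of_trees P G"
proof -
  have s: "sym ((parcs G)\<^sup>*)" using G by (auto simp: pair_graph_iff intro: sym_rtrancl)
  have "simple_tree (component G v)" if v: "v \<in> pverts G" for v
    using component_pair_graph[OF G(1) v] G component_connected[of G _ v]
    by (intro simple_tree_connected_subgraph[OF T]) (auto simp: pair_graph_iff parcs_component)
  moreover have "disjoint_family_on pverts (component G ` pverts G)"
  proof (unfold disjoint_family_on_def, safe)
    fix u v w assume ne: "component G u \<noteq> component G v"
      and "w \<in> pverts (component G u)" "w \<in> pverts (component G v)"
    then have "(u, w) \<in> (parcs G)\<^sup>*" "(v, w) \<in> (parcs G)\<^sup>*" by (auto simp: pverts_component)
    then have "(u, v) \<in> (parcs G)\<^sup>*" "(v, u) \<in> (parcs G)\<^sup>*" using s by (meson rtrancl_trans symD)+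
    then have "(parcs G)\<^sup>* `` {u} = (parcs G)\<^sup>* `` {v}" by (auto intro: rtrancl_trans)
    with ne show "w \<in> {}" by (simp add: component_def)
  qed
  moreover have "pverts G = (\<Union>S\<in>component G ` pverts G. pverts S)"
    using component_pair_graph[OF G(1)] by blast
  moreover have "parcs G = (\<Union>S\<in>component G ` pverts G. parcs S)"
    using G(1) by (auto simp: parcs_component pair_graph_iff)
  ultimately show ?thesis
    unfolding disjoint_union_of_trees_def using P G(1)
    by (intro conjI exI[of _ "component G ` pverts G"]) auto
qed

section \<open>Visibility of axis-aligned boxes\<close>

text \<open>Closed boxes are for blockers, open ones for the two ends: a channel of positive width
  has to fit inside both ends, while merely touching a blocker interrupts it.\<close>

definition in_box :: "nat set \<Rightarrow> (nat \<Rightarrow> real) \<Rightarrow> (nat \<Rightarrow> real) \<Rightarrow> bool" where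
  "in_box J a q \<longleftrightarrow> (\<forall>j\<in>J. a j \<le> q j \<and> q j \<le> a j + 1)"

definition in_open_box :: "nat set \<Rightarrow> (nat \<Rightarrow> real) \<Rightarrow> (nat \<Rightarrow> real) \<Rightarrow> bool" where
  "in_open_box J a q \<longleftrightarrow> (\<forall>j\<in>J. a j < q j \<and> q j < a j + 1)"

text \<open>Visibility along a line through \<open>q\<close>, where \<open>J\<close> are the directions orthogonal to the line and \<open>h\<close> gives
  the heights along it. As blockers are closed, a line that works can be thickened to a channel.\<close>

definition vis ::
    "nat set \<Rightarrow> ('a \<Rightarrow> real) \<Rightarrow> ('a \<Rightarrow> nat \<Rightarrow> real) \<Rightarrow> 'a set \<Rightarrow> 'a \<Rightarrow> 'a \<Rightarrow> bool" where
  "vis J h P V u v \<longleftrightarrow> (\<exists>q. in_open_box J (P u) q \<and> in_open_box J (P v) q \<and>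
     (\<forall>w\<in>V. min (h u) (h v) < h w \<and> h w < max (h u) (h v) \<longrightarrow> \<not> in_box J (P w) q))"

lemma in_open_box_imp_in_box: "in_open_box J a q \<Longrightarrow> in_box J a q"
  by (auto simp: in_box_def in_open_box_def intro: less_imp_le)

lemma vis_sym: "vis J h P V u v \<Longrightarrow> vis J h P V v u"
  unfolding vis_def by (metis min.commute max.commute)

text \<open>Unit cubes (\<open>e = 1\<close>, any \<open>i < d\<close>) and orthogonal unit cubes (\<open>e = 0\<close>, \<open>d = m + 1\<close>, \<open>i = m\<close>) at once.\<close>

definition slab :: "nat \<Rightarrow> nat \<Rightarrow> real \<Rightarrow> (nat \<Rightarrow> real) \<Rightarrow> (nat \<Rightarrow> real) set" where
  "slab d i e a = (\<Pi>\<^sub>E j\<in>{..<d}. {a j..a j + (if j = i then e else 1)})"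

lemma unit_cube_eq_slab: "unit_cube n a = slab n i 1 a"
  by (simp add: unit_cube_def slab_def)

lemma orthogonal_unit_cube_eq_slab: "orthogonal_unit_cube m a = slab (Suc m) m 0 a"
  by (auto simp: orthogonal_unit_cube_def slab_def less_Suc_eq intro!: PiE_cong)

lemma slab_iff:
  assumes "i < d"
  shows "x \<in> slab d i e a \<longleftrightarrow>
    x \<in> extensional {..<d} \<and> in_box ({..<d} - {i}) a x \<and> a i \<le> x i \<and> x i \<le> a i + e"
  using assms by (auto simp: slab_def in_box_def PiE_iff split: if_splits)

lemma slab_disjoint_iff:
  assumes "i < d" "0 \<le> e"
  shows "slab d i e a \<inter> slab d i e b = {} \<longleftrightarrow>
    (\<exists>j<d. (if j = i then e else 1) < \<bar>a j - b j\<bar>)"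
proof -
  have "slab d i e a \<inter> slab d i e b =
      (\<Pi>\<^sub>E j\<in>{..<d}. {a j..a j + (if j = i then e else 1)} \<inter> {b j..b j + (if j = i then e else 1)})"
    by (simp add: slab_def PiE_Int)
  then show ?thesis
    using assms by (auto simp: PiE_eq_empty_iff abs_if split: if_splits) 
qed

text \<open>Boxes whose shadows share a point overlap in every coordinate except possibly
  \<open>i\<close>, so their disjointness must be witnessed by \<open>i\<close>.\<close>

lemma slabs_apart:
  assumes "disjoint_family_on (\<lambda>v. slab d i e (a v)) V" "u \<in> V" "v \<in> V" "u \<noteq> v" "i < d" "0 \<le> e"
    and "in_box ({..<d} - {i}) (a u) q" "in_box ({..<d} - {i}) (a v) q"
  shows "e < \<bar>a u i - a v i\<bar>"
proof -
  obtain j where j: "j < d" "(if j = i then e else 1) < \<bar>a u j - a v j\<bar>"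
    using assms(1-6) slab_disjoint_iff[of i d e] unfolding disjoint_family_on_def by blast
  show ?thesis
  proof (cases "j = i")
    case False
    with j assms(7,8) have "a u j \<le> q j" "q j \<le> a u j + 1" "a v j \<le> q j" "q j \<le> a v j + 1"
      by (auto simp: in_box_def)
    with j False show ?thesis by auto
  qed (use j in auto)
qed

lemma finite_nonzero_bound:
  assumes "finite (X :: real set)"
  shows "\<exists>\<delta>>0. \<forall>x\<in>X. x \<noteq> 0 \<longrightarrow> \<delta> < \<bar>x\<bar>"
  using assms
proof (induct X)
  case (insert x X)
  then obtain \<delta> where \<delta>: "\<delta> > 0" "\<forall>x\<in>X. x \<noteq> 0 \<longrightarrow> \<delta> < \<bar>x\<bar>" by blast
  show ?case
  proof (cases "x = 0")
    case False
    then show ?thesis using \<delta> by (intro exI[of _ "min \<delta> (\<bar>x\<bar> / 2)"]) auto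
  qed (use \<delta> in auto)
qed (auto intro: exI[of _ 1])

text \<open>Take \<open>\<delta>\<close> below every nonzero distance from a coordinate of
  \<open>q\<close> to a face of a box. A perturbation of at most \<open>\<delta>\<close> then never
  leaves an open box and never enters a new closed one, and the shift of all coordinates by exactly
  \<open>\<delta>\<close> avoids all faces, which gives a generic line.\<close>

lemma box_distance:
  assumes "finite J" "finite V"
  shows "\<exists>\<delta>>0. (\<forall>w\<in>V. \<forall>x. (\<forall>j\<in>J. \<bar>x j - q j\<bar> \<le> \<delta>) \<longrightarrow>
      (in_open_box J (P w) q \<longrightarrow> in_open_box J (P w) x) \<and> (in_box J (P w) x \<longrightarrow> in_box J (P w) q)) \<and>
    (\<forall>w\<in>V. \<forall>j\<in>J. q j + \<delta> \<noteq> P w j \<and> q j + \<delta> \<noteq> P w j + 1)"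
proof -
  let ?X = "(\<lambda>(j, w). P w j - q j) ` (J \<times> V) \<union> (\<lambda>(j, w). P w j + 1 - q j) ` (J \<times> V)"
  have "finite ?X" using assms by blast
  from finite_nonzero_bound[OF this]
  obtain \<delta> where \<delta>: "0 < \<delta>" "\<And>x. x \<in> ?X \<Longrightarrow> x \<noteq> 0 \<Longrightarrow> \<delta> < \<bar>x\<bar>"
    by blast
  have d: "P w j \<noteq> q j \<Longrightarrow> \<delta> < \<bar>P w j - q j\<bar>" "P w j + 1 \<noteq> q j \<Longrightarrow> \<delta> < \<bar>P w j + 1 - q j\<bar>"
    if "w \<in> V" "j \<in> J" for w j
    using \<delta>(2)[of "P w j - q j"] \<delta>(2)[of "P w j + 1 - q j"] that by force+
  show ?thesis
  proof (intro exI[of _ \<delta>] conjI ballI allI impI \<delta>(1))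
    fix w x assume w: "w \<in> V" and x: "\<forall>j\<in>J. \<bar>x j - q j\<bar> \<le> \<delta>"
    show "in_open_box J (P w) x" if "in_open_box J (P w) q"
      unfolding in_open_box_def
    proof
      fix j assume j: "j \<in> J"
      with that have "P w j < q j" "q j < P w j + 1" by (auto simp: in_open_box_def)
      with d[OF w j] bspec[OF x j] show "P w j < x j \<and> x j < P w j + 1"
        by (auto simp: abs_if split: if_splits)
    qed
    show "in_box J (P w) q" if "in_box J (P w) x"
      unfolding in_box_def
    proof
      fix j assume j: "j \<in> J"
      with that have "P w j \<le> x j" "x j \<le> P w j + 1" by (auto simp: in_box_def)
      with d[OF w j] bspec[OF x j] show "P w j \<le> q j \<and> q j \<le> P w j + 1"
        by (smt (verit))
    qed
  next
    fix w j assume "w \<in> V" "j \<in> J"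
    with d[of w j] \<delta>(1) show "q j + \<delta> \<noteq> P w j" "q j + \<delta> \<noteq> P w j + 1" by force+
  qed
qed

section \<open>Channels of positive diameter and single lines of sight\<close>

lemma L2_set_single:
  assumes "finite A" "j \<in> A" "0 \<le> r"
  shows "L2_set (\<lambda>k. if k = j then r else 0) A = r"
proof -
  have "(\<Sum>k\<in>A. (if k = j then r else 0)\<^sup>2) = (\<Sum>k\<in>A. if k = j then r\<^sup>2 else 0)"
    by (intro sum.cong) auto
  then show ?thesis using assms by (simp add: L2_set_def)
qed

lemma disc_subset_slabD:
  assumes "disc d i p r s \<subseteq> slab d i e a" "0 < r" "i < d"
  shows "in_open_box ({..<d} - {i}) a p" "a i \<le> s" "s \<le> a i + e"
proof -
  let ?J = "{..<d} - {i}"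
  \<comment> \<open>The disc is tested at its centre and at the two points at distance
    \<open>r\<close> from it along each axis \<open>j\<close>; these already keep \<open>p\<close>
    at distance \<open>r\<close> from both faces.\<close>
  define y where "y z = restrict (\<lambda>j. if j = i then s else p j + z j) {..<d}" for z :: "nat \<Rightarrow> real"
  have L: "L2_set (\<lambda>j. y z j - p j) ?J = L2_set z ?J" for z
    unfolding y_def by (intro L2_set_cong) auto
  have y: "y z \<in> disc d i p r s" if "L2_set z ?J \<le> r" for z
    using that assms(3) unfolding disc_def by (simp add: L) (simp add: y_def)
  have ys: "y z \<in> slab d i e a" if "L2_set z ?J \<le> r" for z
    using y[OF that] assms(1) by blast
  have L0: "L2_set (\<lambda>j. 0) ?J \<le> r" using assms(2) by (simp add: L2_set_def)
  show "a i \<le> s" "s \<le> a i + e"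
    using ys[OF L0] assms(3) by (auto simp: slab_iff y_def)
  show "in_open_box ?J a p"
    unfolding in_open_box_def
  proof
    fix j assume j: "j \<in> ?J"
    have 1: "L2_set (\<lambda>k. if k = j then r else 0) ?J \<le> r"
      using assms(2) j by (subst L2_set_single) auto
    have "L2_set (\<lambda>k. if k = j then - r else 0) ?J = L2_set (\<lambda>k. if k = j then r else 0) ?J"
      unfolding L2_set_def by (intro arg_cong[of _ _ sqrt] sum.cong) auto
    with 1 have 2: "L2_set (\<lambda>k. if k = j then - r else 0) ?J \<le> r" by simp
    have "in_box ?J a (y (\<lambda>k. if k = j then - r else 0))" "in_box ?J a (y (\<lambda>k. if k = j then r else 0))"
      using ys[OF 1] ys[OF 2] assms(3) by (simp_all add: slab_iff)
    then have "a j \<le> y (\<lambda>k. if k = j then - r else 0) j" "y (\<lambda>k. if k = j then r else 0) j \<le> a j + 1"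
      using j by (auto simp only: in_box_def)
    then have "a j \<le> p j - r" "p j + r \<le> a j + 1" using j by (auto simp: y_def)
    then show "a j < p j \<and> p j < a j + 1" using assms(2) by auto
  qed
qed

text \<open>A channel contains its centre line, and conversely finiteness of \<open>V\<close> leaves
  room for a radius around the line through \<open>q\<close>. In both halves
  \<open>slabs_apart\<close> orders the boxes met by a line: they differ by more than the thickness
  \<open>e\<close> in coordinate \<open>i\<close>, so the lower ends \<open>a w i\<close> decide
  which box lies between which.\<close>

lemma sees_slabs_iff_vis:
  assumes V: "finite V" "u \<in> V" "v \<in> V" "u \<noteq> v" and d: "i < d" "0 \<le> e"
    and disj: "disjoint_family_on (\<lambda>w. slab d i e (a w)) V"
  shows "sees d i (\<lambda>w. slab d i e (a w)) V u v \<longleftrightarrow> vis ({..<d} - {i}) (\<lambda>w. a w i) a V u v"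
proof
  let ?J = "{..<d} - {i}"
  assume "sees d i (\<lambda>w. slab d i e (a w)) V u v"
  then obtain p r s t where r: "0 < r" and ds: "disc d i p r s \<subseteq> slab d i e (a u)"
    and dt: "disc d i p r t \<subseteq> slab d i e (a v)"
    and ch: "\<forall>w\<in>V - {u, v}. channel d i p r s t \<inter> slab d i e (a w) = {}"
    unfolding sees_def by blast
  note du = disc_subset_slabD[OF ds r d(1)] and dv = disc_subset_slabD[OF dt r d(1)]
  have "\<not> in_box ?J (a w) p"
    if w: "w \<in> V" "min (a u i) (a v i) < a w i" "a w i < max (a u i) (a v i)" for w
  proof
    assume p: "in_box ?J (a w) p"
    have ne: "w \<noteq> u" "w \<noteq> v" using w by auto
    have "e < \<bar>a w i - a u i\<bar>"
      using slabs_apart[OF disj w(1) V(2) ne(1) d p in_open_box_imp_in_box[OF du(1)]] .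
    moreover have "e < \<bar>a w i - a v i\<bar>"
      using slabs_apart[OF disj w(1) V(3) ne(2) d p in_open_box_imp_in_box[OF dv(1)]] .
    \<comment> \<open>The end discs may lie anywhere inside the two boxes, so \<open>s\<close> and
      \<open>t\<close> are known only up to \<open>e\<close>; gaps larger than \<open>e\<close>
      still put the lower end of \<open>w\<close> between them.\<close>
    ultimately have mid: "a w i \<in> {min s t..max s t}"
      using du(2,3) dv(2,3) w(2,3) d(2) by (auto simp: min_def max_def split: if_splits)
    let ?x = "restrict (p(i := a w i)) {..<d}"
    have "?x \<in> disc d i p r (a w i)"
    proof -
      have "L2_set (\<lambda>j. ?x j - p j) ?J = L2_set (\<lambda>j. 0) ?J"
        by (intro L2_set_cong) auto
      then show ?thesis using d(1) r by (simp add: disc_def L2_set_def)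
    qed
    then have "?x \<in> channel d i p r s t" using mid unfolding channel_def by blast
    moreover have "?x \<in> slab d i e (a w)" using p d by (auto simp: slab_iff in_box_def)
    ultimately show False using ch w(1) ne by blast
  qed
  then show "vis ?J (\<lambda>w. a w i) a V u v"
    unfolding vis_def using du(1) dv(1) by blast
next
  let ?J = "{..<d} - {i}"
  assume "vis ?J (\<lambda>w. a w i) a V u v"
  then obtain q where q: "in_open_box ?J (a u) q" "in_open_box ?J (a v) q"
    and bl: "\<And>w. w \<in> V \<Longrightarrow> min (a u i) (a v i) < a w i \<Longrightarrow> a w i < max (a u i) (a v i) \<Longrightarrow> \<not> in_box ?J (a w) q"
    unfolding vis_def by blast
  obtain r where r: "0 < r"
    and op: "\<And>w x. w \<in> V \<Longrightarrow> \<forall>j\<in>?J. \<bar>x j - q j\<bar> \<le> r \<Longrightarrow> in_open_box ?J (a w) q \<Longrightarrow> in_open_box ?J (a w) x"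
    and cl: "\<And>w x. w \<in> V \<Longrightarrow> \<forall>j\<in>?J. \<bar>x j - q j\<bar> \<le> r \<Longrightarrow> in_box ?J (a w) x \<Longrightarrow> in_box ?J (a w) q"
    using box_distance[of ?J V q a] V(1) by blast
  have near: "\<forall>j\<in>?J. \<bar>x j - q j\<bar> \<le> r" if "x \<in> disc d i q r h" for x h
  proof
    fix j assume "j \<in> ?J"
    then have "\<bar>x j - q j\<bar> \<le> L2_set (\<lambda>j. \<bar>x j - q j\<bar>) ?J"
      using that by (intro member_le_L2_set) auto
    also have "\<dots> = L2_set (\<lambda>j. x j - q j) ?J" by (simp add: L2_set_def)
    finally show "\<bar>x j - q j\<bar> \<le> r" using that by (auto simp: disc_def)
  qed
  have bu: "in_box ?J (a u) x" and bv: "in_box ?J (a v) x" if "x \<in> disc d i q r h" for x h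
    using op[OF V(2) near[OF that]] op[OF V(3) near[OF that]] q in_open_box_imp_in_box by blast+
  have far: "e < \<bar>a u i - a v i\<bar>"
    using slabs_apart[OF disj V(2,3,4) d] q in_open_box_imp_in_box by blast
  \<comment> \<open>These are the facing ends of the two boxes, so the channel runs exactly through
    the gap.\<close>
  define s t where "s = (if a u i < a v i then a u i + e else a u i)"
    and "t = (if a u i < a v i then a v i else a v i + e)"
  have "disc d i q r s \<subseteq> slab d i e (a u)"
    using bu d by (auto simp: slab_iff s_def disc_def)
  moreover have "disc d i q r t \<subseteq> slab d i e (a v)"
    using bv d by (auto simp: slab_iff t_def disc_def)
  moreover have "channel d i q r s t \<inter> slab d i e (a w) = {}" if w: "w \<in> V - {u, v}" for w
  proof (rule ccontr)
    assume "channel d i q r s t \<inter> slab d i e (a w) \<noteq> {}"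
    then obtain x h where x: "x \<in> disc d i q r h" "min s t \<le> h" "h \<le> max s t" "x \<in> slab d i e (a w)"
      by (auto simp: channel_def)
    have xi: "x i = h" using x by (auto simp: disc_def)
    have wx: "in_box ?J (a w) x" "a w i \<le> h" "h \<le> a w i + e" using x(4) xi d by (auto simp: slab_iff)
    have "e < \<bar>a w i - a u i\<bar>"
      using slabs_apart[OF disj _ V(2) _ d wx(1) bu[OF x(1)]] w by blast
    moreover have "e < \<bar>a w i - a v i\<bar>"
      using slabs_apart[OF disj _ V(3) _ d wx(1) bv[OF x(1)]] w by blast
    ultimately have "min (a u i) (a v i) < a w i \<and> a w i < max (a u i) (a v i)"
      using wx(2,3) x(2,3) far d(2) unfolding s_def t_def
      by (auto simp: min_def max_def split: if_splits)
    then show False using bl[of w] w cl[of w x] near[OF x(1)] wx(1) by blast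
  qed
  ultimately show "sees d i (\<lambda>w. slab d i e (a w)) V u v"
    unfolding sees_def using r by blast
qed

text \<open>Serves to exchange direction \<open>i\<close> with the last axis, along which orthogonal
  representations look.\<close>

lemma vis_reindex:
  assumes "bij_betw \<sigma> J' J"
  shows "vis J' h (\<lambda>w j. P w (\<sigma> j)) V u v \<longleftrightarrow> vis J h P V u v"
proof -
  let ?\<tau> = "inv_into J' \<sigma>"
  have \<tau>: "\<sigma> (?\<tau> k) = k" "?\<tau> k \<in> J'" if "k \<in> J" for k
    using assms that by (auto simp: bij_betw_inv_into_right bij_betw_def inv_into_into)
  have \<sigma>: "\<sigma> j \<in> J" "?\<tau> (\<sigma> j) = j" if "j \<in> J'" for j
    using assms that by (auto simp: bij_betw_inv_into_left bij_betw_def)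
  have 1: "in_box J' (\<lambda>j. a (\<sigma> j)) (\<lambda>j. q (\<sigma> j)) \<longleftrightarrow> in_box J a q"
    "in_open_box J' (\<lambda>j. a (\<sigma> j)) (\<lambda>j. q (\<sigma> j)) \<longleftrightarrow> in_open_box J a q" for a q
    using assms by (force simp: in_box_def in_open_box_def bij_betw_def)+
  have 2: "in_box J' (\<lambda>j. a (\<sigma> j)) q \<longleftrightarrow> in_box J a (\<lambda>k. q (?\<tau> k))"
    "in_open_box J' (\<lambda>j. a (\<sigma> j)) q \<longleftrightarrow> in_open_box J a (\<lambda>k. q (?\<tau> k))" for a q
    unfolding in_box_def in_open_box_def using \<sigma> \<tau> by (metis (no_types, lifting))+
  show ?thesis
  proof
    assume "vis J' h (\<lambda>w j. P w (\<sigma> j)) V u v"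
    then show "vis J h P V u v" unfolding vis_def 2 by blast
  next
    assume "vis J h P V u v"
    then obtain q where "in_open_box J (P u) q" "in_open_box J (P v) q"
      "\<forall>w\<in>V. min (h u) (h v) < h w \<and> h w < max (h u) (h v) \<longrightarrow> \<not> in_box J (P w) q"
      unfolding vis_def by blast
    then show "vis J' h (\<lambda>w j. P w (\<sigma> j)) V u v"
      unfolding vis_def by (intro exI[of _ "\<lambda>j. q (\<sigma> j)"]) (simp add: 1)
  qed
qed

lemma cube_visibility_graph_iff:
  fixes G :: "'a pair_pre_digraph"
  assumes "pair_graph G"
  shows "cube_visibility_graph n G \<longleftrightarrow>
    (\<exists>a. disjoint_family_on (\<lambda>v. unit_cube n (a v)) (pverts G) \<and>
      (\<forall>u\<in>pverts G. \<forall>v\<in>pverts G. (u, v) \<in> parcs G \<longleftrightarrow>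
         u \<noteq> v \<and> (\<exists>i<n. vis ({..<n} - {i}) (\<lambda>w. a w i) a (pverts G) u v)))"
proof -
  have "finite (pverts G)" using assms by (simp add: pair_graph_iff)
  then have *: "sees n i (\<lambda>v. unit_cube n (a v)) (pverts G) u v \<longleftrightarrow>
      vis ({..<n} - {i}) (\<lambda>w. a w i) a (pverts G) u v"
    if "disjoint_family_on (\<lambda>v. unit_cube n (a v)) (pverts G)"
      "u \<in> pverts G" "v \<in> pverts G" "u \<noteq> v" "i < n"
    for a :: "'a \<Rightarrow> nat \<Rightarrow> real" and u v i
    using that sees_slabs_iff_vis[of "pverts G" u v i n 1 a]
    by (simp add: unit_cube_eq_slab[of n _ i])
  have "visibility_representation n {..<n} (\<lambda>v. unit_cube n (a v)) G \<longleftrightarrow>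
    disjoint_family_on (\<lambda>v. unit_cube n (a v)) (pverts G) \<and>
      (\<forall>u\<in>pverts G. \<forall>v\<in>pverts G. (u, v) \<in> parcs G \<longleftrightarrow>
         u \<noteq> v \<and> (\<exists>i<n. vis ({..<n} - {i}) (\<lambda>w. a w i) a (pverts G) u v))"
    for a :: "'a \<Rightarrow> nat \<Rightarrow> real"
    unfolding visibility_representation_def using *[of a]
    by (intro conj_cong refl ball_cong) auto
  then show ?thesis using assms by (simp add: cube_visibility_graph_def)
qed

lemma orthogonal_visibility_graph_iff:
  fixes G :: "'a pair_pre_digraph"
  assumes "pair_graph G"
  shows "orthogonal_visibility_graph m G \<longleftrightarrow>
    (\<exists>a. disjoint_family_on (\<lambda>v. orthogonal_unit_cube m (a v)) (pverts G) \<and>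
      (\<forall>u\<in>pverts G. \<forall>v\<in>pverts G. (u, v) \<in> parcs G \<longleftrightarrow>
         u \<noteq> v \<and> vis {..<m} (\<lambda>w. a w m) a (pverts G) u v))"
proof -
  have J: "{..<Suc m} - {m} = {..<m}" by auto
  have "finite (pverts G)" using assms by (simp add: pair_graph_iff)
  then have *: "sees (Suc m) m (\<lambda>v. orthogonal_unit_cube m (a v)) (pverts G) u v \<longleftrightarrow>
      vis {..<m} (\<lambda>w. a w m) a (pverts G) u v"
    if "disjoint_family_on (\<lambda>v. orthogonal_unit_cube m (a v)) (pverts G)"
      "u \<in> pverts G" "v \<in> pverts G" "u \<noteq> v"
    for a :: "'a \<Rightarrow> nat \<Rightarrow> real" and u v
    using that sees_slabs_iff_vis[of "pverts G" u v m "Suc m" 0 a]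
    by (simp add: orthogonal_unit_cube_eq_slab J)
  have "visibility_representation (Suc m) {m} (\<lambda>v. orthogonal_unit_cube m (a v)) G \<longleftrightarrow>
    disjoint_family_on (\<lambda>v. orthogonal_unit_cube m (a v)) (pverts G) \<and>
      (\<forall>u\<in>pverts G. \<forall>v\<in>pverts G. (u, v) \<in> parcs G \<longleftrightarrow>
         u \<noteq> v \<and> vis {..<m} (\<lambda>w. a w m) a (pverts G) u v)"
    for a :: "'a \<Rightarrow> nat \<Rightarrow> real"
    unfolding visibility_representation_def using *[of a]
    by (intro conj_cong refl ball_cong) auto
  then show ?thesis using assms by (simp add: orthogonal_visibility_graph_def)
qed

section \<open>Visibility restricted to connected subsets\<close>

text \<open>Take the lowest box above \<open>u\<close> met by the line: nothing on the line lies
  between. The assumption \<open>gen\<close> turns its closed hit into the open one required of an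
  end of a sighting.\<close>

lemma vis_next:
  assumes V: "finite V" "u \<in> V" "v \<in> V" and uv: "h u < h v"
    and q: "in_box J (P u) q" "in_box J (P v) q"
    and gen: "\<And>w. w \<in> V \<Longrightarrow> in_box J (P w) q \<Longrightarrow> in_open_box J (P w) q"
  shows "\<exists>b\<in>V. in_box J (P b) q \<and> h u < h b \<and> h b \<le> h v \<and> vis J h P V u b"
proof -
  let ?S = "{w \<in> V. in_box J (P w) q \<and> h u < h w \<and> h w \<le> h v}"
  have "finite ?S" "?S \<noteq> {}" using V uv q by auto
  then obtain b where "is_arg_min h (\<lambda>w. w \<in> ?S) b" using ex_is_arg_min_if_finite by blast
  then have b: "b \<in> ?S" "\<And>w. w \<in> ?S \<Longrightarrow> h b \<le> h w" by (auto simp: is_arg_min_linorder)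
  have "vis J h P V u b"
    unfolding vis_def
  proof (intro exI[of _ q] conjI ballI impI notI)
    fix w assume w: "w \<in> V" "min (h u) (h b) < h w \<and> h w < max (h u) (h b)" "in_box J (P w) q"
    then have "w \<in> ?S" using b(1) by auto
    with b w show False by fastforce
  qed (use gen b(1) V q in auto)
  with b(1) show ?thesis by blast
qed

text \<open>Iterates \<open>vis_next\<close>; the number of boxes higher than \<open>u\<close> drops
  at each step. The lower bound \<open>h u\<close> in the relation is the point: a chain started at
  a blocker never returns to anything below that blocker.\<close>

lemma vis_chain:
  assumes V: "finite V" and v: "v \<in> V" "in_box J (P v) q"
    and gen: "\<And>w. w \<in> V \<Longrightarrow> in_box J (P w) q \<Longrightarrow> in_open_box J (P w) q"
    and sep: "\<And>w. w \<in> V \<Longrightarrow> in_box J (P w) q \<Longrightarrow> w \<noteq> v \<Longrightarrow> h w \<noteq> h v"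
    and u: "u \<in> V" "in_box J (P u) q" "h u \<le> h v"
  shows "(u, v) \<in> {(x, y). x \<in> V \<and> y \<in> V \<and> x \<noteq> y \<and> h u \<le> h x \<and> h u \<le> h y \<and> vis J h P V x y}\<^sup>*"
  using u
proof (induct "card {w \<in> V. h u < h w}" arbitrary: u rule: less_induct)
  case less
  let ?R = "\<lambda>u. {(x, y). x \<in> V \<and> y \<in> V \<and> x \<noteq> y \<and> h u \<le> h x \<and> h u \<le> h y \<and> vis J h P V x y}"
  show ?case
  proof (cases "u = v")
    case False
    with sep less.prems have "h u < h v" by fastforce
    from vis_next[of V u v h J P q, OF V less.prems(1) v(1) this less.prems(2) v(2) gen]
    obtain b where b: "b \<in> V" "in_box J (P b) q" "h u < h b" "h b \<le> h v" "vis J h P V u b" by blast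
    have "{w \<in> V. h b < h w} \<subset> {w \<in> V. h u < h w}" using b by auto
    then have "card {w \<in> V. h b < h w} < card {w \<in> V. h u < h w}"
      using V by (intro psubset_card_mono) auto
    from less.hyps[OF this b(1,2,4)] have "(b, v) \<in> (?R b)\<^sup>*" .
    moreover have "?R b \<subseteq> ?R u" using b by auto
    ultimately have "(b, v) \<in> (?R u)\<^sup>*" using rtrancl_mono by blast
    moreover have "(u, b) \<in> ?R u" using b less.prems by auto
    ultimately show ?thesis by (rule converse_rtrancl_into_rtrancl[rotated])
  qed auto
qed

text \<open>Only extra sightings in \<open>A\<close> have to be excluded. Let \<open>u\<close> be
  below \<open>v\<close>, visible from it in \<open>A\<close> but not in \<open>V\<close>, and let
  \<open>b\<close> be the first box of \<open>V\<close> above \<open>u\<close> on a generic line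
  nearby; it is not in \<open>A\<close>. Then \<open>(b, u)\<close> is an arc, but \<open>b\<close>
  also reaches \<open>u\<close> by a chain to \<open>v\<close> that never goes below
  \<open>b\<close>, followed by a walk inside \<open>A\<close>. Neither part contains
  \<open>(b, u)\<close>, against \<open>bridging\<close>.\<close>

lemma vis_connected_subset:
  assumes fin: "finite J" "finite V" and A: "A \<subseteq> V" "u \<in> A" "v \<in> A" "u \<noteq> v"
    and E: "E \<subseteq> V \<times> V" "bridging E"
      "\<And>x y. x \<in> V \<Longrightarrow> y \<in> V \<Longrightarrow> (x, y) \<in> E \<longleftrightarrow> x \<noteq> y \<and> vis J h P V x y"
    and sep: "\<And>x y q. x \<in> V \<Longrightarrow> y \<in> V \<Longrightarrow> x \<noteq> y \<Longrightarrow> in_box J (P x) q \<Longrightarrow> in_box J (P y) q \<Longrightarrow> h x \<noteq> h y"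
    and conn: "\<And>x y. x \<in> A \<Longrightarrow> y \<in> A \<Longrightarrow> (x, y) \<in> (E \<inter> A \<times> A)\<^sup>*"
  shows "vis J h P A u v \<longleftrightarrow> vis J h P V u v"
proof
  show "vis J h P V u v \<Longrightarrow> vis J h P A u v" using A(1) unfolding vis_def by blast
next
  have *: "vis J h P V u v" if vA: "vis J h P A u v" and uv: "h u < h v" "u \<in> A" "v \<in> A" for u v
  proof -
    have V: "u \<in> V" "v \<in> V" using uv A by auto
    obtain q where q: "in_open_box J (P u) q" "in_open_box J (P v) q"
      and bl0: "\<forall>w\<in>A. min (h u) (h v) < h w \<and> h w < max (h u) (h v) \<longrightarrow> \<not> in_box J (P w) q"
      using vA unfolding vis_def by blast
    have bl: "\<not> in_box J (P w) q" if "w \<in> A" "h u < h w" "h w < h v" for w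
      using bl0 that uv(1) by auto
    obtain \<delta> where d: "0 < \<delta>"
      and op: "\<And>w x. w \<in> V \<Longrightarrow> \<forall>j\<in>J. \<bar>x j - q j\<bar> \<le> \<delta> \<Longrightarrow> in_open_box J (P w) q \<Longrightarrow> in_open_box J (P w) x"
      and cl: "\<And>w x. w \<in> V \<Longrightarrow> \<forall>j\<in>J. \<bar>x j - q j\<bar> \<le> \<delta> \<Longrightarrow> in_box J (P w) x \<Longrightarrow> in_box J (P w) q"
      and ne: "\<And>w j. w \<in> V \<Longrightarrow> j \<in> J \<Longrightarrow> q j + \<delta> \<noteq> P w j \<and> q j + \<delta> \<noteq> P w j + 1"
      using box_distance[OF fin, of q P] by blast
    \<comment> \<open>The shifted line is generic: it keeps both ends, meets no new box, and runs
      through the interior of every box that it meets.\<close>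
    define q' where "q' j = q j + \<delta>" for j
    have q': "in_open_box J (P u) q'" "in_open_box J (P v) q'"
      using op[OF V(1), of q'] op[OF V(2), of q'] q d by (auto simp: q'_def)
    then have q'': "in_box J (P u) q'" "in_box J (P v) q'" by (auto intro: in_open_box_imp_in_box)
    have bl': "\<not> in_box J (P w) q'" if "w \<in> A" "h u < h w" "h w < h v" for w
      using bl[OF that] cl[of w q'] that(1) A d by (auto simp: q'_def)
    have gen: "in_open_box J (P w) q'" if "w \<in> V" "in_box J (P w) q'" for w
      unfolding in_open_box_def
    proof
      fix j assume j: "j \<in> J"
      have "P w j \<le> q' j" "q' j \<le> P w j + 1" using that(2) j unfolding in_box_def by auto
      moreover have "q' j \<noteq> P w j" "q' j \<noteq> P w j + 1"
        using ne[OF that(1) j] by (auto simp: q'_def)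
      ultimately show "P w j < q' j \<and> q' j < P w j + 1" by linarith
    qed
    obtain b where b: "b \<in> V" "in_box J (P b) q'" "h u < h b" "h b \<le> h v" "vis J h P V u b"
      using vis_next[OF fin(2) V uv(1), of J P q'] gen q'' by blast
    show ?thesis
    proof (cases "b = v")
      case False
      then have "h b < h v" using b sep[OF b(1) V(2) False b(2) q''(2)] by auto
      then have bA: "b \<notin> A" using bl' b by blast
      let ?R = "{(x, y). x \<in> V \<and> y \<in> V \<and> x \<noteq> y \<and> h b \<le> h x \<and> h b \<le> h y \<and> vis J h P V x y}"
      let ?A = "(E \<inter> A \<times> A) \<union> ?R"
      have "(b, v) \<in> ?R\<^sup>*"
        using sep[OF _ V(2) _ _ q''(2)] by (intro vis_chain[OF fin(2) V(2) q''(2) gen _ b(1,2,4)])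
      moreover have "(v, u) \<in> (E \<inter> A \<times> A)\<^sup>*" using conn uv by blast
      ultimately have "(b, u) \<in> ?A\<^sup>*"
        by (blast intro: in_rtrancl_UnI rtrancl_trans)
      moreover have "?A \<subseteq> E" using E(3) by auto
      moreover have "(b, u) \<in> E" using E(3) b V vis_sym[OF b(5)] by auto
      ultimately have "(b, u) \<in> ?A" using bridgingD[OF E(2)] by blast
      with bA b(3) show ?thesis by auto
    qed (use b in auto)
  qed
  assume v: "vis J h P A u v"
  then obtain q where "in_open_box J (P u) q" "in_open_box J (P v) q" unfolding vis_def by blast
  then have "h u \<noteq> h v" using sep[of u v q] A in_open_box_imp_in_box by blast
  then consider "h u < h v" | "h v < h u" by linarith
  then show "vis J h P V u v"
  proof cases
    case 1
    then show ?thesis using *[OF v _ A(2,3)] by blast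
  next
    case 2
    then show ?thesis using *[OF vis_sym[OF v] _ A(3,2)] by (blast intro: vis_sym)
  qed
qed

section \<open>Growing a tree leaf by leaf\<close>

inductive grown :: "'a set \<Rightarrow> ('a \<times> 'a) set \<Rightarrow> bool" where
  single: "grown {v} {}"
| leaf: "grown V E \<Longrightarrow> u \<in> V \<Longrightarrow> v \<notin> V \<Longrightarrow> grown (insert v V) (insert (u, v) (insert (v, u) E))"

lemma grown_props:
  assumes "grown V E"
  shows "finite V" "E \<subseteq> V \<times> V" "sym E" "\<And>x y. x \<in> V \<Longrightarrow> y \<in> V \<Longrightarrow> (x, y) \<in> E\<^sup>*"
proof -
  have "finite V \<and> E \<subseteq> V \<times> V \<and> sym E \<and> (\<forall>x\<in>V. \<forall>y\<in>V. (x, y) \<in> E\<^sup>*)"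
    using assms
  proof induct
    case (leaf V E u v)
    let ?E = "insert (u, v) (insert (v, u) E)"
    have m: "(x, y) \<in> ?E\<^sup>*" if "x \<in> V" "y \<in> V" for x y
      using leaf(2) that rtrancl_mono[of E ?E] by blast
    have "(u, v) \<in> ?E\<^sup>*" "(v, u) \<in> ?E\<^sup>*" by blast+
    then have "(x, y) \<in> ?E\<^sup>*" if "x \<in> insert v V" "y \<in> insert v V" for x y
      using that m[of x y] m[of x u] m[of u y] leaf(3) by (auto intro: rtrancl_trans)
    with leaf show ?case by (auto simp: sym_def)
  qed (auto simp: sym_def)
  then show "finite V" "E \<subseteq> V \<times> V" "sym E" "\<And>x y. x \<in> V \<Longrightarrow> y \<in> V \<Longrightarrow> (x, y) \<in> E\<^sup>*" by auto
qed

lemma rtrancl_leaves_set: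
  assumes "(x, y) \<in> E\<^sup>*" "x \<in> W" "y \<notin> W"
  shows "\<exists>u v. (u, v) \<in> E \<and> u \<in> W \<and> v \<notin> W"
  using assms by (induct rule: rtrancl_induct) auto

text \<open>Extend a grown \<open>W\<close> by any arc \<open>(u, v)\<close> leaving it. Were
  \<open>v\<close> joined to a second vertex \<open>x\<close> of \<open>W\<close>, the walk from
  \<open>x\<close> to \<open>u\<close> inside \<open>W\<close> and on to \<open>v\<close> would
  bypass the arc \<open>(x, v)\<close>. So \<open>v\<close> is a leaf, and the induced arcs grow
  exactly as in the rule \<open>leaf\<close>.\<close>

lemma bridging_tree_grown:
  assumes V: "finite V" "V \<noteq> {}" and E: "E \<subseteq> V \<times> V" "sym E" "irrefl E" "bridging E"
    and conn: "\<And>x y. x \<in> V \<Longrightarrow> y \<in> V \<Longrightarrow> (x, y) \<in> E\<^sup>*"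
  shows "grown V E"
proof -
  have "grown V E" if "W \<subseteq> V" "grown W (E \<inter> W \<times> W)" for W
    using that
  proof (induct "card (V - W)" arbitrary: W rule: less_induct)
    case less
    note W = less.prems
    have ne: "W \<noteq> {}" using W(2) by cases auto
    show ?case
    proof (cases "W = V")
      case True
      with W E(1) show ?thesis by (simp add: Int_absorb2)
    next
      case False
      then obtain x y where "x \<in> W" "y \<in> V" "y \<notin> W" using W ne by blast
      then obtain u v where uv: "(u, v) \<in> E" "u \<in> W" "v \<notin> W"
        using rtrancl_leaves_set[of x y E W] conn[of x y] W(1) by blast
      have v: "v \<in> V" using uv E by auto
      have uniq: "x = u" if x: "(x, v) \<in> E" "x \<in> W" for x
      proof -
        let ?A = "insert (u, v) (E \<inter> W \<times> W)"
        have "(x, u) \<in> (E \<inter> W \<times> W)\<^sup>*" using grown_props(4)[OF W(2)] x uv by blast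
        then have "(x, u) \<in> ?A\<^sup>*" using rtrancl_mono[of "E \<inter> W \<times> W" ?A] by blast
        then have "(x, v) \<in> ?A\<^sup>*" by (rule rtrancl_into_rtrancl) auto
        then have "(x, v) \<in> ?A" using bridgingD[OF E(4) x(1), of ?A] uv by blast
        with uv show ?thesis by auto
      qed
      have uniq': "x = u" if "(v, x) \<in> E" "x \<in> W" for x
        using uniq that symD[OF E(2)] by blast
      have "(v, u) \<in> E" "(v, v) \<notin> E"
        using uv E(3) symD[OF E(2)] by (auto simp: irrefl_def)
      then have "E \<inter> insert v W \<times> insert v W = insert (u, v) (insert (v, u) (E \<inter> W \<times> W))"
        using uniq uniq' uv by blast
      then have "grown (insert v W) (E \<inter> insert v W \<times> insert v W)"
        using grown.leaf[OF W(2) uv(2,3)] by simp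
      moreover have "card (V - insert v W) < card (V - W)"
        using v uv V by (intro psubset_card_mono) auto
      ultimately show ?thesis using less.hyps[of "insert v W"] W v by blast
    qed
  qed
  moreover obtain v where v: "v \<in> V" using V by blast
  moreover have "E \<inter> {v} \<times> {v} = {}" using E by (auto simp: irrefl_def)
  then have "grown {v} (E \<inter> {v} \<times> {v})" by (simp only: grown.single)
  ultimately show ?thesis by blast
qed

section \<open>Embedding an arc-coloured tree\<close>

definition colour_class :: "('a \<times> 'a \<Rightarrow> nat) \<Rightarrow> ('a \<times> 'a) set \<Rightarrow> nat \<Rightarrow> ('a \<times> 'a) set" where
  "colour_class c E i = {e \<in> E. c e = i}"

lemma sym_colour_class:
  assumes "sym E" "\<And>u v. (u, v) \<in> E \<Longrightarrow> c (v, u) = c (u, v)"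
  shows "sym ((colour_class c E i)\<^sup>*)"
  using assms by (intro sym_rtrancl symI) (auto simp: colour_class_def dest: symD)

lemma rtrancl_with_leaf:
  assumes "(x, y) \<in> (insert (u, v) (insert (v, u) R))\<^sup>*" "R \<subseteq> V \<times> V" "u \<in> V" "v \<notin> V" "x \<in> V"
  shows "if y = v then (x, u) \<in> R\<^sup>* else (x, y) \<in> R\<^sup>*"
  using assms(1)
proof (induct rule: rtrancl_induct)
  case base
  then show ?case using assms by auto
next
  case (step y z)
  then show ?case using assms by (auto split: if_splits intro: rtrancl_into_rtrancl)
qed

lemma colour_class_leaf:
  assumes "E \<subseteq> V \<times> V" "u \<in> V" "v \<notin> V" "c (v, u) = c (u, v)"
    and E': "E' = insert (u, v) (insert (v, u) E)"
  shows "x \<in> V \<Longrightarrow> y \<in> V \<Longrightarrow> (x, y) \<in> (colour_class c E' i)\<^sup>* \<longleftrightarrow> (x, y) \<in> (colour_class c E i)\<^sup>*"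
    and "y \<in> V \<Longrightarrow> (v, y) \<in> (colour_class c E' i)\<^sup>* \<longleftrightarrow> i = c (u, v) \<and> (u, y) \<in> (colour_class c E i)\<^sup>*"
proof -
  let ?R = "colour_class c E i"
  have R: "?R \<subseteq> V \<times> V" using assms by (auto simp: colour_class_def)
  have eq: "colour_class c E' i = (if i = c (u, v) then insert (u, v) (insert (v, u) ?R) else ?R)"
    using assms by (auto simp: colour_class_def)
  have mono: "?R\<^sup>* \<subseteq> (insert (u, v) (insert (v, u) ?R))\<^sup>*" by (rule rtrancl_mono) auto
  show "(x, y) \<in> (colour_class c E' i)\<^sup>* \<longleftrightarrow> (x, y) \<in> ?R\<^sup>*" if "x \<in> V" "y \<in> V"
    using rtrancl_with_leaf[of x y u v ?R V] R that assms(1-3) mono unfolding eq by (auto split: if_splits)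
  show "(v, y) \<in> (colour_class c E' i)\<^sup>* \<longleftrightarrow> i = c (u, v) \<and> (u, y) \<in> ?R\<^sup>*" if y: "y \<in> V"
  proof (cases "i = c (u, v)")
    case True
    have "(v, y) \<in> (insert (u, v) (insert (v, u) ?R))\<^sup>* \<longleftrightarrow> (u, y) \<in> (insert (u, v) (insert (v, u) ?R))\<^sup>*"
      by (meson converse_rtrancl_into_rtrancl insertI1 insertI2)
    then show ?thesis
      using True rtrancl_with_leaf[of u y u v ?R V] R y assms(1-3) mono unfolding eq by (auto split: if_splits)
  next
    case False
    have "(v, y) \<notin> ?R\<^sup>*"
    proof
      assume "(v, y) \<in> ?R\<^sup>*"
      then show False using R y assms(1-3) by (cases rule: converse_rtranclE) auto
    qed
    with False show ?thesis by (simp add: eq)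
  qed
qed

text \<open>Pigeonhole: an interval of length \<open>2 * K * (card W + 1)\<close> above
  \<open>Lo\<close> and below \<open>Hi\<close> splits into \<open>card W + 1\<close> slots of width
  \<open>2 * K\<close>, and each value \<open>f w\<close> is closer than \<open>K\<close> to at most
  one of their midpoints.\<close>

lemma separated_slot:
  fixes f :: "'a \<Rightarrow> real" and K :: real
  assumes W: "finite W" "Lo \<subseteq> W" "Hi \<subseteq> W" and K: "0 < K"
    and gap: "\<And>l r. l \<in> Lo \<Longrightarrow> r \<in> Hi \<Longrightarrow> f l + 2 * K * (card W + 1) \<le> f r"
  shows "\<exists>y. (\<forall>w\<in>W. K \<le> \<bar>y - f w\<bar>) \<and> (\<forall>l\<in>Lo. f l < y) \<and> (\<forall>r\<in>Hi. y < f r)"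
proof -
  let ?D = "2 * K * (card W + 1)"
  have fin: "finite Lo" "finite Hi" using W finite_subset by blast+
  obtain a where a: "\<And>l. l \<in> Lo \<Longrightarrow> f l \<le> a" "\<And>r. r \<in> Hi \<Longrightarrow> a + ?D \<le> f r"
  proof (cases "Lo = {}")
    case False
    show ?thesis
    proof (rule that[of "Max (f ` Lo)"])
      show "f l \<le> Max (f ` Lo)" if "l \<in> Lo" for l using that fin by simp
      have "Max (f ` Lo) \<in> f ` Lo" using fin False by simp
      then show "Max (f ` Lo) + ?D \<le> f r" if "r \<in> Hi" for r using gap that by auto
    qed
  next
    case True
    \<comment> \<open>With \<open>Lo\<close> empty the interval ends at or below all values of
      \<open>Hi\<close>; the inserted 0 keeps \<open>Min\<close> meaningful when \<open>Hi\<close>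
      is empty too.\<close>
    show ?thesis
    proof (rule that[of "Min (insert 0 (f ` Hi)) - ?D"])
      show "Min (insert 0 (f ` Hi)) - ?D + ?D \<le> f r" if "r \<in> Hi" for r
        using that fin by simp
    qed (use True in auto)
  qed
  \<comment> \<open>The midpoints of the slots, counted from the left end \<open>a\<close> of the
    interval.\<close>
  define y where "y k = a + (2 * real k + 1) * K" for k
  have "\<exists>k\<le>card W. \<forall>w\<in>W. K \<le> \<bar>y k - f w\<bar>"
  proof (rule ccontr)
    assume "\<not> ?thesis"
    then have "\<exists>w\<in>W. \<bar>y k - f w\<bar> < K" if "k \<le> card W" for k
      using that by (meson not_le)
    then obtain g where g: "\<And>k. k \<le> card W \<Longrightarrow> g k \<in> W \<and> \<bar>y k - f (g k)\<bar> < K"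
      by metis
    have "inj_on g {..card W}"
    proof (rule inj_onI, rule ccontr)
      fix k l assume kl: "k \<in> {..card W}" "l \<in> {..card W}" "g k = g l" "k \<noteq> l"
      then have "\<bar>y k - y l\<bar> < 2 * K" using g[of k] g[of l] by auto
      moreover have "1 \<le> \<bar>real k - real l\<bar>" using kl by auto
      then have "2 * K * 1 \<le> 2 * K * \<bar>real k - real l\<bar>" using K by (intro mult_left_mono) auto
      moreover have "y k - y l = 2 * K * (real k - real l)" by (simp add: y_def algebra_simps)
      then have "\<bar>y k - y l\<bar> = 2 * K * \<bar>real k - real l\<bar>" using K by (simp add: abs_mult)
      ultimately show False by linarith
    qed
    then have "card {..card W} \<le> card W"
      using g W by (intro card_inj_on_le[of g]) auto
    then show False by simp
  qed
  then obtain k where k: "k \<le> card W" "\<forall>w\<in>W. K \<le> \<bar>y k - f w\<bar>" by blast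
  have "a < y k" using K by (simp add: y_def)
  moreover have "(2 * real k + 1) * K < 2 * K * (card W + 1)"
    using K k(1) by (simp add: mult.commute)
  then have "y k < a + ?D" by (simp add: y_def)
  ultimately show ?thesis using k a by (intro exI[of _ "y k"]) force
qed

text \<open>The condition on a pair of vertices for direction \<open>i\<close>; \<open>b\<close> says whether they lie in the same component
  of colour \<open>i\<close>, and \<open>h i\<close>, \<open>P i\<close> are the heights and positions in the orthogonal representation of that component.\<close>

definition well_placed ::
    "nat \<Rightarrow> (nat \<Rightarrow> 'a \<Rightarrow> real) \<Rightarrow> (nat \<Rightarrow> 'a \<Rightarrow> nat \<Rightarrow> real) \<Rightarrow> real \<Rightarrow> ('a \<Rightarrow> nat \<Rightarrow> real) \<Rightarrow>
     nat \<Rightarrow> bool \<Rightarrow> 'a \<Rightarrow> 'a \<Rightarrow> bool" where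
  "well_placed n h P K x i b u v \<longleftrightarrow> (if b
     then K \<le> \<bar>x u i - x v i\<bar> \<and> (h i u < h i v \<longrightarrow> x u i < x v i) \<and> (h i v < h i u \<longrightarrow> x v i < x u i) \<and>
       (\<forall>j<n. j \<noteq> i \<longrightarrow> x u j - x v j = P i u j - P i v j)
     else \<exists>j<n. j \<noteq> i \<and> K \<le> \<bar>x u j - x v j\<bar>)"

lemma well_placed_sym: "well_placed n h P K x i b u v \<Longrightarrow> well_placed n h P K x i b v u"
  unfolding well_placed_def by (auto simp: abs_minus_commute algebra_simps split: if_splits)

lemma well_placed_cong:
  "x u = y u \<Longrightarrow> x v = y v \<Longrightarrow> well_placed n h P K x i b u v \<longleftrightarrow> well_placed n h P K y i b u v"
  by (simp add: well_placed_def)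

lemma well_placed_mono: "well_placed n h P K' x i b u v \<Longrightarrow> K \<le> K' \<Longrightarrow> well_placed n h P K x i b u v"
  unfolding well_placed_def by (auto split: if_splits intro: order_trans)

text \<open>\<open>K\<close> varies in the induction because the old tree has to be spread out more
  than the new one. The bound by 1 on differences of \<open>P\<close> reflects that the shadows of
  visible pairs overlap; it limits how far a leaf strays from its neighbour.\<close>

lemma tree_embedding:
  assumes "grown V E"
    and "\<And>u v. (u, v) \<in> E \<Longrightarrow> c (u, v) < n \<and> c (v, u) = c (u, v) \<and>
      (\<forall>j<n. j \<noteq> c (u, v) \<longrightarrow> \<bar>P (c (u, v)) u j - P (c (u, v)) v j\<bar> \<le> 1)"
    and "1 \<le> K"
  shows "\<exists>x. \<forall>i<n. \<forall>u\<in>V. \<forall>v\<in>V. u \<noteq> v \<longrightarrow>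
    well_placed n h P K x i ((u, v) \<in> (colour_class c E i)\<^sup>*) u v"
  using assms
proof (induct arbitrary: K)
  case (single v)
  then show ?case by auto
next
  case (leaf V E u v)
  note V = grown_props[OF leaf(1)]
  let ?i = "c (u, v)" and ?E = "insert (u, v) (insert (v, u) E)"
  have cc: "?i < n" "c (v, u) = ?i" and P1: "\<And>j. j < n \<Longrightarrow> j \<noteq> ?i \<Longrightarrow> \<bar>P ?i u j - P ?i v j\<bar> \<le> 1"
    using leaf.prems(1)[of u v] by auto
  have cs: "c (b, a) = c (a, b)" if "(a, b) \<in> E" for a b using leaf.prems(1)[of a b] that by auto
  have cs': "c (b, a) = c (a, b)" if "(a, b) \<in> ?E" for a b using cs that cc by auto
  have symE: "sym ?E" using V(3) by (auto simp: sym_def)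
  note cl = colour_class_leaf[OF V(2) leaf(3,4) cc(2) refl]
  \<comment> \<open>The old tree gets gap \<open>D + 1\<close>: \<open>D\<close> is the room that
    \<open>separated_slot\<close> needs between two old heights of a component, and the extra 1 pays
    for the offset of the leaf from \<open>u\<close>, so that cubes far from \<open>u\<close> stay
    at distance \<open>K\<close> from the leaf.\<close>
  define D where "D = 2 * K * (card V + 1)"
  have "2 * K * 1 \<le> D" unfolding D_def using leaf.prems(2) by (intro mult_left_mono) auto
  then have K': "1 \<le> D + 1" "K + 1 \<le> D + 1" using leaf.prems(2) by linarith+
  obtain x where x: "\<And>i a b. i < n \<Longrightarrow> a \<in> V \<Longrightarrow> b \<in> V \<Longrightarrow> a \<noteq> b \<Longrightarrow>
      well_placed n h P (D + 1) x i ((a, b) \<in> (colour_class c E i)\<^sup>*) a b"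
  proof -
    have "\<exists>x. \<forall>i<n. \<forall>u\<in>V. \<forall>v\<in>V. u \<noteq> v \<longrightarrow>
        well_placed n h P (D + 1) x i ((u, v) \<in> (colour_class c E i)\<^sup>*) u v"
      by (rule leaf(2)[OF _ K'(1)], rule leaf.prems(1)) simp
    then show thesis using that by metis
  qed
  let ?C = "(colour_class c E ?i)\<^sup>* `` {u} \<inter> V"
  let ?Lo = "{w \<in> ?C. h ?i w < h ?i v}" and ?Hi = "{w \<in> ?C. h ?i v < h ?i w}"
  have "x l ?i + D \<le> x r ?i" if "l \<in> ?Lo" "r \<in> ?Hi" for l r
  proof -
    have "(l, r) \<in> (colour_class c E ?i)\<^sup>*"
    proof -
      have "(u, l) \<in> (colour_class c E ?i)\<^sup>*" "(u, r) \<in> (colour_class c E ?i)\<^sup>*" using that by auto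
      then show ?thesis using symD[OF sym_colour_class[of E c, OF V(3) cs]] by (meson rtrancl_trans)
    qed
    moreover have "l \<noteq> r" "h ?i l < h ?i r" using that by auto
    ultimately have "D + 1 \<le> \<bar>x l ?i - x r ?i\<bar>" "x l ?i < x r ?i"
      using x[OF cc(1), of l r] that by (auto simp: well_placed_def)
    then show ?thesis by linarith
  qed
  then have "\<exists>y. (\<forall>w\<in>V. K \<le> \<bar>y - x w ?i\<bar>) \<and> (\<forall>l\<in>?Lo. x l ?i < y) \<and> (\<forall>r\<in>?Hi. y < x r ?i)"
    using leaf.prems(2) unfolding D_def by (intro separated_slot V(1)) auto
  then obtain y where y: "\<And>w. w \<in> V \<Longrightarrow> K \<le> \<bar>y - x w ?i\<bar>"
      "\<And>w. w \<in> ?Lo \<Longrightarrow> x w ?i < y" "\<And>w. w \<in> ?Hi \<Longrightarrow> y < x w ?i" by blast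
  \<comment> \<open>Only coordinate \<open>?i\<close> is free; the others are forced by the offset
    from \<open>u\<close> in colour \<open>?i\<close>. The free one separates \<open>v\<close> from
    all old vertices in every other direction.\<close>
  define x' where "x' = x(v := \<lambda>j. if j = ?i then y else x u j + (P ?i v j - P ?i u j))"
  have x'V: "x' w = x w" if "w \<in> V" for w using that leaf(4) by (auto simp: x'_def)
  have new: "well_placed n h P K x' i ((v, w) \<in> (colour_class c ?E i)\<^sup>*) v w" if i: "i < n" and w: "w \<in> V" for i w
  proof -
    have vj: "x' v j = x u j + (P ?i v j - P ?i u j)" if "j \<noteq> ?i" for j
      using that by (auto simp: x'_def)
    have vi: "x' v ?i = y" by (simp add: x'_def)
    consider (other) "i \<noteq> ?i" | (same) "i = ?i" "(u, w) \<in> (colour_class c E ?i)\<^sup>*"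
      | (apart) "i = ?i" "(u, w) \<notin> (colour_class c E ?i)\<^sup>*" by blast
    then show ?thesis
    proof cases
      case other
      then show ?thesis using cl(2)[OF w, of i] vi y(1)[OF w] x'V[OF w] cc(1)
        by (auto simp: well_placed_def)
    next
      case same
      have "x u j - x w j = P ?i u j - P ?i w j" if "j < n" "j \<noteq> ?i" for j
        using x[OF cc(1) leaf(3) w] same that by (cases "u = w") (auto simp: well_placed_def)
      then have "x' v j - x' w j = P ?i v j - P ?i w j" if "j < n" "j \<noteq> ?i" for j
        using that vj[of j] x'V[OF w] by fastforce
      moreover have "h ?i w < h ?i v \<longrightarrow> x' w ?i < x' v ?i" "h ?i v < h ?i w \<longrightarrow> x' v ?i < x' w ?i"
        using y(2,3)[of w] same w vi x'V[OF w] by auto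
      ultimately show ?thesis
        using same cl(2)[OF w, of i] vi y(1)[OF w] x'V[OF w] by (auto simp: well_placed_def)
    next
      case apart
      then have "u \<noteq> w" by auto
      then obtain j where j: "j < n" "j \<noteq> ?i" "D + 1 \<le> \<bar>x u j - x w j\<bar>"
        using x[OF cc(1) leaf(3) w] apart by (auto simp: well_placed_def)
      then have "K \<le> \<bar>x' v j - x' w j\<bar>"
        using P1[of j] vj[of j] x'V[OF w] K'(2) by (simp split: abs_split)
      then show ?thesis using apart j cl(2)[OF w, of i] by (auto simp: well_placed_def)
    qed
  qed
  show ?case
  proof (intro exI[of _ x'] allI impI ballI)
    fix i a b assume i: "i < n" and ab: "a \<in> insert v V" "b \<in> insert v V" "a \<noteq> b"
    let ?r = "(colour_class c ?E i)\<^sup>*"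
    have sy: "(a, b) \<in> ?r \<longleftrightarrow> (b, a) \<in> ?r" using sym_colour_class[of ?E c, OF symE cs'] by (meson symD)
    consider "a = v" "b \<in> V" | "b = v" "a \<in> V" | "a \<in> V" "b \<in> V" using ab by blast
    then show "well_placed n h P K x' i ((a, b) \<in> ?r) a b"
    proof cases
      case 1
      then show ?thesis using new[OF i] by simp
    next
      case 2
      then show ?thesis using well_placed_sym[OF new[OF i 2(2)]] sy by simp
    next
      case 3
      have "K \<le> D + 1" using K'(2) by simp
      from well_placed_mono[OF x[OF i 3 ab(3)] this]
      show ?thesis using cl(1)[OF 3, of i] well_placed_cong[of x' a x b] x'V 3 by simp
    qed
  qed
qed

section \<open>Cube representations from orthogonal ones\<close>

text \<open>Seen in direction \<open>i\<close>, an embedded component of colour \<open>i\<close> is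
  a translate of its orthogonal representation, with heights changed but their order kept wherever
  shadows meet. Cubes outside the component cannot meet its lines of sight.\<close>

lemma cube_visibility_graph_of_colour_classes:
  assumes G: "pair_graph G" "bridging (parcs G)" "pverts G \<noteq> {}"
      "\<And>u v. u \<in> pverts G \<Longrightarrow> v \<in> pverts G \<Longrightarrow> (u, v) \<in> (parcs G)\<^sup>*"
    and n: "1 \<le> n"
    and c: "\<And>u v. (u, v) \<in> parcs G \<Longrightarrow> c (u, v) < n \<and> c (v, u) = c (u, v)"
    and data: "\<And>i u v. i < n \<Longrightarrow> u \<noteq> v \<Longrightarrow> (u, v) \<in> (colour_class c (parcs G) i)\<^sup>* \<Longrightarrow>
        vis ({..<n} - {i}) (h i) (P i) ((colour_class c (parcs G) i)\<^sup>* `` {u}) u v \<longleftrightarrow>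
          (u, v) \<in> colour_class c (parcs G) i"
      "\<And>i u v q. i < n \<Longrightarrow> u \<noteq> v \<Longrightarrow> (u, v) \<in> (colour_class c (parcs G) i)\<^sup>* \<Longrightarrow>
        in_box ({..<n} - {i}) (P i u) q \<Longrightarrow> in_box ({..<n} - {i}) (P i v) q \<Longrightarrow> h i u \<noteq> h i v"
  shows "cube_visibility_graph n G"
proof -
  let ?V = "pverts G" and ?E = "parcs G"
  let ?cc = "colour_class c (parcs G)"
  have V: "finite ?V" "?E \<subseteq> ?V \<times> ?V" "sym ?E" "irrefl ?E" using G(1) by (auto simp: pair_graph_iff)
  have ccE: "?cc i \<subseteq> ?E" for i by (auto simp: colour_class_def)
  have symc: "sym ((?cc i)\<^sup>*)" for i using sym_colour_class[of ?E c] V(3) c by blast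
  have bound: "\<bar>P (c (u, v)) u j - P (c (u, v)) v j\<bar> \<le> 1"
    if e: "(u, v) \<in> ?E" and j: "j < n" "j \<noteq> c (u, v)" for u v j
  proof -
    let ?i = "c (u, v)"
    have uv: "u \<noteq> v" "(u, v) \<in> ?cc ?i" using e V(4) by (auto simp: irrefl_def colour_class_def)
    have "vis ({..<n} - {?i}) (h ?i) (P ?i) ((?cc ?i)\<^sup>* `` {u}) u v"
      using data(1)[of ?i u v] c[OF e] uv by blast
    then obtain q where q: "in_open_box ({..<n} - {?i}) (P ?i u) q" "in_open_box ({..<n} - {?i}) (P ?i v) q"
      unfolding vis_def by blast
    have "P ?i u j < q j" "q j < P ?i u j + 1" "P ?i v j < q j" "q j < P ?i v j + 1"
      using q j by (auto simp: in_open_box_def)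
    then show ?thesis by linarith
  qed
  have "grown ?V ?E" by (rule bridging_tree_grown[OF V(1) G(3) V(2-4) G(2) G(4)])
  \<comment> \<open>The gap 2 exceeds the side length 1, so cubes with this gap in some orthogonal
    coordinate have no common shadow point.\<close>
  then have "\<exists>x. \<forall>i<n. \<forall>u\<in>?V. \<forall>v\<in>?V. u \<noteq> v \<longrightarrow> well_placed n h P 2 x i ((u, v) \<in> (?cc i)\<^sup>*) u v"
    using c bound by (intro tree_embedding) auto
  then obtain x where x: "\<And>i u v. i < n \<Longrightarrow> u \<in> ?V \<Longrightarrow> v \<in> ?V \<Longrightarrow> u \<noteq> v \<Longrightarrow>
      well_placed n h P 2 x i ((u, v) \<in> (?cc i)\<^sup>*) u v"
    by metis
  have disj: "disjoint_family_on (\<lambda>v. unit_cube n (x v)) ?V"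
    unfolding disjoint_family_on_def
  proof (intro ballI impI)
    fix u v assume uv: "u \<in> ?V" "v \<in> ?V" "u \<noteq> v"
    \<comment> \<open>Direction 0 suffices: within a component of colour 0 the gap is in coordinate
      0 itself, otherwise in another coordinate.\<close>
    have "\<exists>j<n. 2 \<le> \<bar>x u j - x v j\<bar>"
      using x[of 0 u v] uv n by (auto simp: well_placed_def Suc_le_eq split: if_splits)
    then obtain j where j: "j < n" "2 \<le> \<bar>x u j - x v j\<bar>" by blast
    then have "(if j = 0 then 1 else 1) < \<bar>x u j - x v j\<bar>" by simp
    then show "unit_cube n (x u) \<inter> unit_cube n (x v) = {}"
      using n j(1) unfolding unit_cube_eq_slab[of n _ 0]
      by (subst slab_disjoint_iff) auto
  qed
  have far: False if i: "i < n" and uv: "u \<in> ?V" "v \<in> ?V" "(u, v) \<notin> (?cc i)\<^sup>*"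
    and q: "in_box ({..<n} - {i}) (x u) q" "in_box ({..<n} - {i}) (x v) q" for i u v q
  proof -
    have "u \<noteq> v" using uv by auto
    then obtain j where j: "j < n" "j \<noteq> i" "2 \<le> \<bar>x u j - x v j\<bar>"
      using x[OF i uv(1,2)] uv(3) by (auto simp: well_placed_def)
    have "x u j \<le> q j" "q j \<le> x u j + 1" "x v j \<le> q j" "q j \<le> x v j + 1"
      using q j by (auto simp: in_box_def)
    with j(3) show False by linarith
  qed
  have main: "vis ({..<n} - {i}) (\<lambda>w. x w i) x ?V u v \<longleftrightarrow> (u, v) \<in> ?cc i"
    if i: "i < n" and uv: "u \<in> ?V" "v \<in> ?V" "u \<noteq> v" for i u v
  proof (cases "(u, v) \<in> (?cc i)\<^sup>*")
    case False
    have "\<not> vis ({..<n} - {i}) (\<lambda>w. x w i) x ?V u v"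
      using far[OF i uv(1,2) False] in_open_box_imp_in_box unfolding vis_def by blast
    with False show ?thesis by blast
  next
    case True
    let ?J = "{..<n} - {i}" and ?C = "(?cc i)\<^sup>* `` {u}"
    \<comment> \<open>The translation is read off at \<open>u\<close>; all vertices of the component
      share it.\<close>
    let ?t = "\<lambda>j. x u j - P i u j"
    have CV: "w \<in> ?V" if "w \<in> ?C" for w
      using rtrancl_in_field[of u w "?cc i" ?V] ccE V(2) that uv(1) by blast
    have CC: "(w, w') \<in> (?cc i)\<^sup>*" if "w \<in> ?C" "w' \<in> ?C" for w w'
      using that symD[OF symc] by (meson Image_singleton_iff rtrancl_trans)
    have shift: "x w j = P i w j + ?t j" if "w \<in> ?C" "j \<in> ?J" for w j
    proof (cases "w = u")
      case False
      have "x u j - x w j = P i u j - P i w j"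
        using x[OF i uv(1) CV[OF that(1)]] False that by (auto simp: well_placed_def)
      then show ?thesis by linarith
    qed simp
    have box: "in_box ?J (x w) q \<longleftrightarrow> in_box ?J (P i w) (\<lambda>j. q j - ?t j)"
      "in_open_box ?J (x w) q \<longleftrightarrow> in_open_box ?J (P i w) (\<lambda>j. q j - ?t j)" if "w \<in> ?C" for w q
      using shift[OF that] unfolding in_box_def in_open_box_def by (smt (verit))+
    \<comment> \<open>\<open>well_placed\<close> says nothing about the order of equal heights;
      boxes with a common shadow point have distinct heights by \<open>data(2)\<close>.\<close>
    have ord: "x w i < x w' i \<longleftrightarrow> h i w < h i w'"
      if w: "w \<in> ?C" "w' \<in> ?C" and q: "in_box ?J (P i w) q" "in_box ?J (P i w') q" for w w' q
    proof (cases "w = w'")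
      case False
      have "h i w \<noteq> h i w'" using data(2)[OF i False CC[OF w] q] .
      moreover have "h i w < h i w' \<longrightarrow> x w i < x w' i" "h i w' < h i w \<longrightarrow> x w' i < x w i"
        using x[OF i CV[OF w(1)] CV[OF w(2)] False] CC[OF w] by (auto simp: well_placed_def)
      ultimately show ?thesis by linarith
    qed simp
    have uC: "u \<in> ?C" and vC: "v \<in> ?C" using True by auto
    have "vis ?J (\<lambda>w. x w i) x ?V u v \<longleftrightarrow> vis ?J (h i) (P i) ?C u v"
    proof
      assume "vis ?J (\<lambda>w. x w i) x ?V u v"
      then obtain q where q: "in_open_box ?J (x u) q" "in_open_box ?J (x v) q"
        and bl: "\<And>w. w \<in> ?V \<Longrightarrow> min (x u i) (x v i) < x w i \<Longrightarrow> x w i < max (x u i) (x v i) \<Longrightarrow> \<not> in_box ?J (x w) q"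
        unfolding vis_def by blast
      let ?q = "\<lambda>j. q j - ?t j"
      have q': "in_open_box ?J (P i u) ?q" "in_open_box ?J (P i v) ?q"
        using q box(2)[OF uC] box(2)[OF vC] by blast+
      note q'' = in_open_box_imp_in_box[OF q'(1)] in_open_box_imp_in_box[OF q'(2)]
      have "\<not> in_box ?J (P i w) ?q"
        if w: "w \<in> ?C" "min (h i u) (h i v) < h i w \<and> h i w < max (h i u) (h i v)" for w
      proof
        assume b: "in_box ?J (P i w) ?q"
        have "min (x u i) (x v i) < x w i" "x w i < max (x u i) (x v i)"
          using w(2) ord[OF uC w(1) q''(1) b] ord[OF w(1) uC b q''(1)] ord[OF vC w(1) q''(2) b]
            ord[OF w(1) vC b q''(2)]
          by (auto simp: min_less_iff_disj less_max_iff_disj)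
        then show False using bl[OF CV[OF w(1)]] box(1)[OF w(1)] b by blast
      qed
      then show "vis ?J (h i) (P i) ?C u v" unfolding vis_def using q' by blast
    next
      assume "vis ?J (h i) (P i) ?C u v"
      then obtain q where q: "in_open_box ?J (P i u) q" "in_open_box ?J (P i v) q"
        and bl: "\<And>w. w \<in> ?C \<Longrightarrow> min (h i u) (h i v) < h i w \<Longrightarrow> h i w < max (h i u) (h i v) \<Longrightarrow> \<not> in_box ?J (P i w) q"
        unfolding vis_def by blast
      let ?q = "\<lambda>j. q j + ?t j"
      note q'' = in_open_box_imp_in_box[OF q(1)] in_open_box_imp_in_box[OF q(2)]
      have q': "in_open_box ?J (x u) ?q" "in_open_box ?J (x v) ?q"
        using q box(2)[OF uC, of ?q] box(2)[OF vC, of ?q] by simp_all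
      have "\<not> in_box ?J (x w) ?q"
        if w: "w \<in> ?V" "min (x u i) (x v i) < x w i \<and> x w i < max (x u i) (x v i)" for w
      proof
        assume b: "in_box ?J (x w) ?q"
        have wC: "w \<in> ?C"
          using far[OF i uv(1) w(1) _ in_open_box_imp_in_box[OF q'(1)] b] by blast
        have b': "in_box ?J (P i w) q" using b box(1)[OF wC, of ?q] by simp
        have "min (h i u) (h i v) < h i w" "h i w < max (h i u) (h i v)"
          using w(2) ord[OF uC wC q''(1) b'] ord[OF wC uC b' q''(1)] ord[OF vC wC q''(2) b']
            ord[OF wC vC b' q''(2)]
          by (auto simp: min_less_iff_disj less_max_iff_disj)
        then show False using bl[OF wC] b' by blast
      qed
      then show "vis ?J (\<lambda>w. x w i) x ?V u v" unfolding vis_def using q' by blast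
    qed
    then show ?thesis using data(1)[OF i uv(3) True] by blast
  qed
  have "(u, v) \<in> ?E \<longleftrightarrow> u \<noteq> v \<and> (\<exists>i<n. vis ({..<n} - {i}) (\<lambda>w. x w i) x ?V u v)"
    if "u \<in> ?V" "v \<in> ?V" for u v
  proof (cases "u = v")
    case False
    then show ?thesis using main[OF _ that False] c[of u v] by (auto simp: colour_class_def)
  qed (use V(4) in \<open>auto simp: irrefl_def\<close>)
  with disj show ?thesis
    unfolding cube_visibility_graph_iff[OF G(1)] by blast
qed

section \<open>Orthogonal data for the components of one colour\<close>

lemma vis_cong:
  assumes "\<And>w. w \<in> V \<Longrightarrow> h w = h' w" "\<And>w. w \<in> V \<Longrightarrow> P w = P' w" "u \<in> V" "v \<in> V"
  shows "vis J h P V u v \<longleftrightarrow> vis J h' P' V u v"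
  using assms unfolding vis_def by (auto cong: ball_cong)

text \<open>Every nontrivial component of \<open>R\<close> lies within one tree \<open>S\<close> of
  \<open>F\<close>, and the representation of \<open>S\<close> restricts to it by
  \<open>vis_connected_subset\<close>. \<open>R\<close> may lack arcs of \<open>F\<close>, but by
  \<open>bridging\<close> none between vertices that it connects. Different components may come from
  different trees, so \<open>h\<close> and \<open>P\<close> are glued from all
  representations.\<close>

lemma orthogonal_forest_class_data:
  fixes F :: "'a pair_pre_digraph"
  assumes E: "bridging E" "parcs F \<subseteq> E" and F: "orthogonal_visibility_forest m F"
    and R: "R \<subseteq> parcs F" "sym R" and \<sigma>: "bij_betw \<sigma> J {..<m}"
  shows "\<exists>h P. \<forall>u v. u \<noteq> v \<longrightarrow> (u, v) \<in> R\<^sup>* \<longrightarrow>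
    (vis J h P (R\<^sup>* `` {u}) u v \<longleftrightarrow> (u, v) \<in> R) \<and>
    (\<forall>q. in_box J (P u) q \<longrightarrow> in_box J (P v) q \<longrightarrow> h u \<noteq> (h v :: real))"
proof -
  from F obtain \<T> where "\<forall>S\<in>\<T>. simple_tree S \<and> orthogonal_visibility_graph m S"
    and \<T>: "disjoint_family_on pverts \<T>" "parcs F = (\<Union>S\<in>\<T>. parcs S)"
    unfolding orthogonal_visibility_forest_def disjoint_union_of_trees_def by (elim conjE exE) rule
  then have tr: "simple_tree S" "orthogonal_visibility_graph m S" if "S \<in> \<T>" for S
    using that by simp_all
  have pg: "pair_graph S" if "S \<in> \<T>" for S using tr(1)[OF that] by (simp add: simple_tree_def)
  have wf: "x \<in> pverts S" "y \<in> pverts S" if "S \<in> \<T>" "(x, y) \<in> parcs S" for S x y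
    using pg[OF that(1)] that(2) by (auto simp: pair_graph_iff)
  have "\<forall>S\<in>\<T>. \<exists>a. disjoint_family_on (\<lambda>v. orthogonal_unit_cube m (a v)) (pverts S) \<and>
      (\<forall>u\<in>pverts S. \<forall>v\<in>pverts S. (u, v) \<in> parcs S \<longleftrightarrow>
         u \<noteq> v \<and> vis {..<m} (\<lambda>w. a w m) a (pverts S) u v)"
    using tr(2) orthogonal_visibility_graph_iff[OF pg] by simp
  from bchoice[OF this] obtain a where
    "\<forall>S\<in>\<T>. disjoint_family_on (\<lambda>v. orthogonal_unit_cube m (a S v)) (pverts S) \<and>
      (\<forall>u\<in>pverts S. \<forall>v\<in>pverts S. (u, v) \<in> parcs S \<longleftrightarrow>
         u \<noteq> v \<and> vis {..<m} (\<lambda>w. a S w m) (a S) (pverts S) u v)" ..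
  then have a: "disjoint_family_on (\<lambda>v. orthogonal_unit_cube m (a S v)) (pverts S)"
    "\<And>u v. u \<in> pverts S \<Longrightarrow> v \<in> pverts S \<Longrightarrow> (u, v) \<in> parcs S \<longleftrightarrow>
         u \<noteq> v \<and> vis {..<m} (\<lambda>w. a S w m) (a S) (pverts S) u v" if "S \<in> \<T>" for S
    using that by simp_all
  \<comment> \<open>The tree containing \<open>v\<close>, unique because the trees are disjoint. For
    a vertex in no tree the value is arbitrary, and such a vertex has no arc in
    \<open>R\<close>.\<close>
  define t where "t v = (SOME S. S \<in> \<T> \<and> v \<in> pverts S)" for v
  have uniq: "S = S'" if "S \<in> \<T>" "S' \<in> \<T>" "v \<in> pverts S" "v \<in> pverts S'" for S S' v
    using \<T>(1) that unfolding disjoint_family_on_def by blast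
  have t: "t v = S" if "S \<in> \<T>" "v \<in> pverts S" for S v
  proof -
    have "t v \<in> \<T> \<and> v \<in> pverts (t v)" unfolding t_def by (rule someI[of _ S]) (use that in blast)
    then show ?thesis using uniq that by blast
  qed
  have tree_of: "\<exists>S\<in>\<T>. (x, y) \<in> parcs S" if "(x, y) \<in> R" for x y
    using subsetD[OF R(1) that] by (simp add: \<T>(2))
  define h where "h v = a (t v) v m" for v
  define P where "P v j = a (t v) v (\<sigma> j)" for v j
  have J: "{..<Suc m} - {m} = {..<m}" by auto
  have "(vis J h P (R\<^sup>* `` {u}) u v \<longleftrightarrow> (u, v) \<in> R) \<and>
    (\<forall>q. in_box J (P u) q \<longrightarrow> in_box J (P v) q \<longrightarrow> h u \<noteq> h v)"
    if uv: "u \<noteq> v" "(u, v) \<in> R\<^sup>*" for u v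
  proof -
    obtain y where "(u, y) \<in> R" using uv by (meson converse_rtranclE)
    then obtain S where "S \<in> \<T>" "(u, y) \<in> parcs S" using tree_of by blast
    then have S: "S \<in> \<T>" "u \<in> pverts S" using wf by simp_all
    let ?V = "pverts S" and ?C = "R\<^sup>* `` {u}"
    have RS: "(x, y) \<in> parcs S" if "(x, y) \<in> R" "x \<in> ?V" for x y
    proof -
      from tree_of[OF that(1)] obtain S' where S': "S' \<in> \<T>" "(x, y) \<in> parcs S'" by blast
      moreover have "S' = S" using uniq[OF S'(1) S(1) wf(1)[OF S'] that(2)] .
      ultimately show ?thesis by simp
    qed
    have CV: "?C \<subseteq> ?V"
    proof
      fix w assume "w \<in> ?C"
      then have "(u, w) \<in> R\<^sup>*" by simp
      then show "w \<in> ?V" by (induct rule: rtrancl_induct) (use S RS wf in blast)+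
    qed
    have conn: "(x, y) \<in> (parcs S \<inter> ?C \<times> ?C)\<^sup>*" if "x \<in> ?C" "y \<in> ?C" for x y
    proof -
      have "(x, y) \<in> (R \<inter> ?C \<times> ?C)\<^sup>*"
        using component_connected[of "\<lparr>pverts = UNIV, parcs = R\<rparr>" x u y] R(2) that
        by (simp add: pverts_component parcs_component)
      moreover have "R \<inter> ?C \<times> ?C \<subseteq> parcs S \<inter> ?C \<times> ?C" using RS CV by blast
      ultimately show ?thesis using rtrancl_mono by blast
    qed
    have hP: "h w = a S w m" "P w = (\<lambda>j. a S w (\<sigma> j))" if "w \<in> ?V" for w
      using t[OF S(1) that] by (auto simp: h_def P_def)
    have sep: "a S x m \<noteq> a S y m"
      if "x \<in> ?V" "y \<in> ?V" "x \<noteq> y" "in_box {..<m} (a S x) q" "in_box {..<m} (a S y) q" for x y q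
      using slabs_apart[of "Suc m" m 0 "a S" ?V x y q] a(1)[OF S(1)] that
      unfolding orthogonal_unit_cube_eq_slab J by auto
    have Sb: "parcs S \<subseteq> E" using \<T>(2) S(1) E(2) by blast
    have u: "u \<in> ?C" "v \<in> ?C" using uv by auto
    have "vis J h P ?C u v \<longleftrightarrow> vis J (\<lambda>w. a S w m) (\<lambda>w j. a S w (\<sigma> j)) ?C u v"
      using hP CV u by (intro vis_cong) auto
    also have "\<dots> \<longleftrightarrow> vis {..<m} (\<lambda>w. a S w m) (a S) ?C u v"
      by (rule vis_reindex[OF \<sigma>])
    also have "\<dots> \<longleftrightarrow> vis {..<m} (\<lambda>w. a S w m) (a S) ?V u v"
    proof (rule vis_connected_subset[of _ _ _ _ _ "parcs S"])
      show "finite ?V" "parcs S \<subseteq> ?V \<times> ?V" using pg[OF S(1)] by (auto simp: pair_graph_iff)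
      show "bridging (parcs S)" using bridging_subset[OF E(1) Sb] .
      show "a S x m \<noteq> a S y m"
        if "x \<in> ?V" "y \<in> ?V" "x \<noteq> y" "in_box {..<m} (a S x) q" "in_box {..<m} (a S y) q" for x y q
        using sep[OF that] .
    qed (fact CV u uv(1) a(2)[OF S(1)] conn finite_lessThan)+
    also have "\<dots> \<longleftrightarrow> (u, v) \<in> parcs S" using a(2)[OF S(1)] u CV uv(1) by blast
    also have "\<dots> \<longleftrightarrow> (u, v) \<in> R"
      using bridgingD[OF E(1) _ subset_trans[OF R(1) E(2)] uv(2)] Sb RS[OF _ S(2)] by blast
    finally have 1: "vis J h P ?C u v \<longleftrightarrow> (u, v) \<in> R" .
    have "h u \<noteq> h v" if "in_box J (P u) q" "in_box J (P v) q" for q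
    proof -
      have \<tau>: "\<sigma> (inv_into J \<sigma> k) = k" "inv_into J \<sigma> k \<in> J" if "k < m" for k
        using \<sigma> that by (auto simp: bij_betw_def f_inv_into_f inv_into_into)
      have "in_box {..<m} (a S w) (\<lambda>k. q (inv_into J \<sigma> k))" if "w \<in> ?V" "in_box J (P w) q" for w
        unfolding in_box_def
      proof
        fix k assume k: "k \<in> {..<m}"
        then have "P w (inv_into J \<sigma> k) = a S w k" using hP(2)[OF that(1)] \<tau>(1)[of k] by simp
        then show "a S w k \<le> q (inv_into J \<sigma> k) \<and> q (inv_into J \<sigma> k) \<le> a S w k + 1"
          using that(2) \<tau>(2)[of k] k unfolding in_box_def by fastforce
      qed
      then show ?thesis using sep[of u v] that u CV uv(1) hP(1) by (metis subsetD)
    qed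
    with 1 show ?thesis by blast
  qed
  then show ?thesis by blast
qed

lemma bij_betw_transpose_coordinates:
  assumes "i < Suc m"
  shows "bij_betw (transpose i m) {..<m} ({..<Suc m} - {i})"
    and "bij_betw (transpose i m) ({..<Suc m} - {i}) {..<m}"
proof -
  have "transpose i m ` {..<m} = {..<Suc m} - {i}"
  proof (intro equalityI subsetI)
    fix j assume "j \<in> {..<Suc m} - {i}"
    then have "transpose i m j \<in> {..<m}" "j = transpose i m (transpose i m j)"
      using assms by (auto simp: transpose_def)
    then show "j \<in> transpose i m ` {..<m}" by blast
  qed (use assms in \<open>auto simp: transpose_def\<close>)
  then show *: "bij_betw (transpose i m) {..<m} ({..<Suc m} - {i})"
    by (auto simp: bij_betw_def transpose_def inj_on_def)
  show "bij_betw (transpose i m) ({..<Suc m} - {i}) {..<m}"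
    by (rule bij_betw_byWitness[of _ "transpose i m"]) (use assms in \<open>auto simp: transpose_def\<close>)
qed

section \<open>Decompositions into forests\<close>

text \<open>Exchanging the coordinates \<open>i\<close> and \<open>m\<close> makes the viewing
  direction the last axis; \<open>vis_connected_subset\<close> then discards the cubes outside the
  component without creating arcs.\<close>

lemma orthogonal_visibility_component:
  assumes D: "pair_graph D" "bridging (parcs D)" and i: "i < Suc m"
    and disj: "disjoint_family_on (\<lambda>v. unit_cube (Suc m) (a v)) (pverts D)"
    and arcs: "\<And>u v. u \<in> pverts D \<Longrightarrow> v \<in> pverts D \<Longrightarrow> (u, v) \<in> parcs D \<longleftrightarrow>
      u \<noteq> v \<and> vis ({..<Suc m} - {i}) (\<lambda>w. a w i) a (pverts D) u v"
    and x: "x \<in> pverts D"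
  shows "orthogonal_visibility_graph m (component D x)"
proof -
  let ?\<sigma> = "transpose i m" and ?J = "{..<Suc m} - {i}" and ?C = "pverts (component D x)"
  define a' where "a' v j = a v (?\<sigma> j)" for v j
  have V: "finite (pverts D)" "parcs D \<subseteq> pverts D \<times> pverts D" "sym (parcs D)" "irrefl (parcs D)"
    using D(1) by (auto simp: pair_graph_iff)
  note C = component_pair_graph[OF D(1) x]
  have sep: "a u i \<noteq> a v i"
    if "u \<in> pverts D" "v \<in> pverts D" "u \<noteq> v" "in_box ?J (a u) q" "in_box ?J (a v) q" for u v q
    using slabs_apart[of "Suc m" i 1 a "pverts D" u v q] disj i that
    unfolding unit_cube_eq_slab[of _ _ i] by auto
  have 1: "vis {..<m} (\<lambda>w. a' w m) a' ?C u v \<longleftrightarrow> vis ?J (\<lambda>w. a w i) a (pverts D) u v"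
    if uv: "u \<in> ?C" "v \<in> ?C" "u \<noteq> v" for u v
  proof -
    have "vis {..<m} (\<lambda>w. a' w m) a' ?C u v \<longleftrightarrow> vis {..<m} (\<lambda>w. a w i) (\<lambda>w j. a w (?\<sigma> j)) ?C u v"
      by (simp add: a'_def[abs_def])
    also have "\<dots> \<longleftrightarrow> vis ?J (\<lambda>w. a w i) a ?C u v"
      by (rule vis_reindex[OF bij_betw_transpose_coordinates(1)[OF i]])
    also have "\<dots> \<longleftrightarrow> vis ?J (\<lambda>w. a w i) a (pverts D) u v"
    proof (rule vis_connected_subset[of _ _ _ _ _ "parcs D"])
      show "finite ?J" by simp
      show "a u i \<noteq> a v i"
        if "u \<in> pverts D" "v \<in> pverts D" "u \<noteq> v" "in_box ?J (a u) q" "in_box ?J (a v) q" for u v q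
        using sep[OF that] .
      show "(u, v) \<in> (parcs D \<inter> ?C \<times> ?C)\<^sup>*" if "u \<in> ?C" "v \<in> ?C" for u v
        using component_connected[OF V(3) that] by (simp add: parcs_component pverts_component)
    qed (fact V C uv arcs D(2))+
    finally show ?thesis .
  qed
  have "disjoint_family_on (\<lambda>v. orthogonal_unit_cube m (a' v)) ?C"
    unfolding disjoint_family_on_def
  proof (intro ballI impI)
    fix u v assume uv: "u \<in> ?C" "v \<in> ?C" "u \<noteq> v"
    have "slab (Suc m) i 1 (a u) \<inter> slab (Suc m) i 1 (a v) = {}"
      using disj uv C(2) unfolding disjoint_family_on_def unit_cube_eq_slab[of _ _ i] by blast
    then obtain j where j: "j < Suc m" "1 < \<bar>a u j - a v j\<bar>"
      using i by (subst (asm) slab_disjoint_iff) auto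
    let ?j = "?\<sigma> j"
    have "?j < Suc m" using j(1) i by (simp add: transpose_def)
    \<comment> \<open>Flattening a cube in the viewing direction only lowers the required gap from 1
      to 0, so disjointness survives.\<close>
    moreover have "(if ?j = m then 0 else 1) < \<bar>a' u ?j - a' v ?j\<bar>"
    proof -
      have "a' u ?j = a u j" "a' v ?j = a v j" by (simp_all add: a'_def)
      with j(2) show ?thesis by (smt (verit))
    qed
    ultimately have "\<exists>j<Suc m. (if j = m then 0 else 1) < \<bar>a' u j - a' v j\<bar>" by blast
    then show "orthogonal_unit_cube m (a' u) \<inter> orthogonal_unit_cube m (a' v) = {}"
      using slab_disjoint_iff[of m "Suc m" 0 "a' u" "a' v"]
      unfolding orthogonal_unit_cube_eq_slab by blast
  qed
  moreover have "(u, v) \<in> parcs (component D x) \<longleftrightarrow> u \<noteq> v \<and> vis {..<m} (\<lambda>w. a' w m) a' ?C u v"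
    if uv: "u \<in> ?C" "v \<in> ?C" for u v
  proof -
    have "(u, v) \<in> parcs (component D x) \<longleftrightarrow> (u, v) \<in> parcs D"
      using uv by (simp add: parcs_component pverts_component)
    then show ?thesis using arcs[of u v] 1[OF uv] uv C(2) by blast
  qed
  ultimately show ?thesis
    unfolding orthogonal_visibility_graph_iff[OF C(1)] by blast
qed

lemma rtrancl_Image_closed:
  assumes "R' \<subseteq> R" "R' \<subseteq> V \<times> V" "v \<in> V" "\<And>x y. (x, y) \<in> R \<Longrightarrow> x \<in> V \<Longrightarrow> (x, y) \<in> R'"
  shows "R\<^sup>* `` {v} = R'\<^sup>* `` {v}"
proof -
  have "(v, w) \<in> R'\<^sup>* \<and> w \<in> V" if "(v, w) \<in> R\<^sup>*" for w
    using that
  proof (induct rule: rtrancl_induct)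
    case (step y z)
    then have "(y, z) \<in> R'" using assms(4) by simp
    with step assms(2) show ?case by (auto intro: rtrancl_into_rtrancl)
  qed (use assms in simp)
  moreover have "R'\<^sup>* \<subseteq> R\<^sup>*" using assms(1) by (rule rtrancl_mono)
  ultimately show ?thesis by auto
qed

text \<open>The trees of \<open>F\<close> have unrelated representations, so the arcs of direction
  \<open>i\<close> are collected tree by tree. Every \<open>D i\<close> keeps all vertices of
  \<open>F\<close>, isolated ones becoming one-vertex trees; an arc seen in several directions
  occurs in several \<open>D i\<close>, which a union permits.\<close>

lemma cube_visibility_forest_directions:
  fixes F :: "'a pair_pre_digraph"
  assumes T: "simple_tree T" and F: "cube_visibility_forest (Suc m) F"
    and sub: "pverts F \<subseteq> pverts T" "parcs F \<subseteq> parcs T"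
  shows "\<exists>D. (\<forall>i<Suc m. orthogonal_visibility_forest m (D i) \<and> pverts (D i) = pverts F) \<and>
    parcs F = (\<Union>i<Suc m. parcs (D i))"
proof -
  from F obtain \<T> where "\<forall>S\<in>\<T>. simple_tree S \<and> cube_visibility_graph (Suc m) S"
    and \<T>: "disjoint_family_on pverts \<T>" "pverts F = (\<Union>S\<in>\<T>. pverts S)" "parcs F = (\<Union>S\<in>\<T>. parcs S)"
      "pair_graph F"
    unfolding cube_visibility_forest_def disjoint_union_of_trees_def by (elim conjE exE) rule
  then have tr: "simple_tree S" "cube_visibility_graph (Suc m) S" if "S \<in> \<T>" for S
    using that by simp_all
  have pg: "pair_graph S" if "S \<in> \<T>" for S using tr(1)[OF that] by (simp add: simple_tree_def)
  have "\<forall>S\<in>\<T>. \<exists>a. disjoint_family_on (\<lambda>v. unit_cube (Suc m) (a v)) (pverts S) \<and>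
      (\<forall>u\<in>pverts S. \<forall>v\<in>pverts S. (u, v) \<in> parcs S \<longleftrightarrow>
         u \<noteq> v \<and> (\<exists>i<Suc m. vis ({..<Suc m} - {i}) (\<lambda>w. a w i) a (pverts S) u v))"
    using tr(2) cube_visibility_graph_iff[OF pg] by simp
  from bchoice[OF this] obtain a where
    "\<forall>S\<in>\<T>. disjoint_family_on (\<lambda>v. unit_cube (Suc m) (a S v)) (pverts S) \<and>
      (\<forall>u\<in>pverts S. \<forall>v\<in>pverts S. (u, v) \<in> parcs S \<longleftrightarrow>
         u \<noteq> v \<and> (\<exists>i<Suc m. vis ({..<Suc m} - {i}) (\<lambda>w. a S w i) (a S) (pverts S) u v))" ..
  then have a: "disjoint_family_on (\<lambda>v. unit_cube (Suc m) (a S v)) (pverts S)"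
    "\<And>u v. u \<in> pverts S \<Longrightarrow> v \<in> pverts S \<Longrightarrow> (u, v) \<in> parcs S \<longleftrightarrow>
         u \<noteq> v \<and> (\<exists>i<Suc m. vis ({..<Suc m} - {i}) (\<lambda>w. a S w i) (a S) (pverts S) u v)" if "S \<in> \<T>" for S
    using that by simp_all
  define E where "E i S = {(u, v). u \<in> pverts S \<and> v \<in> pverts S \<and> u \<noteq> v \<and>
    vis ({..<Suc m} - {i}) (\<lambda>w. a S w i) (a S) (pverts S) u v}" for i S
  define D where "D i = \<lparr>pverts = pverts F, parcs = \<Union>S\<in>\<T>. E i S\<rparr>" for i
  have ES: "parcs S = (\<Union>i<Suc m. E i S)" if "S \<in> \<T>" for S
  proof -
    have S: "parcs S \<subseteq> pverts S \<times> pverts S" using pg[OF that] by (auto simp: pair_graph_iff)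
    have "(x, y) \<in> parcs S \<longleftrightarrow> (\<exists>i<Suc m. (x, y) \<in> E i S)" for x y
    proof (cases "x \<in> pverts S \<and> y \<in> pverts S")
      case True
      then show ?thesis using a(2)[OF that, of x y] by (auto simp: E_def)
    next
      case False
      then show ?thesis using S by (auto simp: E_def)
    qed
    then show ?thesis by (auto simp: set_eq_iff)
  qed
  have "orthogonal_visibility_forest m (D i)" if i: "i < Suc m" for i
    unfolding orthogonal_visibility_forest_def
  proof (rule disjoint_union_of_components[OF T])
    have symE: "sym (E i S)" for S by (auto simp: E_def intro!: symI vis_sym)
    have DF: "parcs (D i) \<subseteq> parcs F" unfolding \<T>(3) D_def using ES i by auto
    have "sym (parcs (D i))"
      using symE by (auto simp: D_def intro!: symI dest: symD)
    then show pgD: "pair_graph (D i)"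
      using \<T>(4) DF by (auto simp: pair_graph_iff irrefl_def D_def)
    show "pverts (D i) \<subseteq> pverts T" "parcs (D i) \<subseteq> parcs T" using sub DF by (auto simp: D_def)
    fix v assume "v \<in> pverts (D i)"
    then obtain S where S: "S \<in> \<T>" "v \<in> pverts S" by (auto simp: D_def \<T>(2))
    let ?D = "\<lparr>pverts = pverts S, parcs = E i S\<rparr>"
    \<comment> \<open>Arcs of \<open>D i\<close> never leave the tree in which they start, so the
      component of \<open>D i\<close> at \<open>v\<close> can be computed inside
      \<open>S\<close>.\<close>
    have closed: "(x, y) \<in> E i S" if xy: "(x, y) \<in> parcs (D i)" "x \<in> pverts S" for x y
    proof -
      from xy(1) obtain S' where S': "S' \<in> \<T>" "(x, y) \<in> E i S'" by (auto simp: D_def)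
      then have "x \<in> pverts S'" by (simp add: E_def)
      then have "S' = S" using \<T>(1) S(1) S'(1) xy(2) unfolding disjoint_family_on_def by blast
      with S' show ?thesis by simp
    qed
    have sub': "E i S \<subseteq> parcs (D i)" "E i S \<subseteq> pverts S \<times> pverts S"
      using S(1) by (auto simp: D_def E_def)
    have im: "(parcs (D i))\<^sup>* `` {v} = (E i S)\<^sup>* `` {v}"
      by (rule rtrancl_Image_closed[OF sub' S(2) closed])
    have "(E i S)\<^sup>* `` {v} \<subseteq> pverts S" using rtrancl_in_field[OF _ sub'(2) S(2)] by auto
    then have "parcs (D i) \<inter> ((E i S)\<^sup>* `` {v}) \<times> ((E i S)\<^sup>* `` {v}) =
        E i S \<inter> ((E i S)\<^sup>* `` {v}) \<times> ((E i S)\<^sup>* `` {v})"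
      using closed sub'(1) by blast
    then have "component (D i) v = component ?D v"
      using im by (simp add: component_def Let_def)
    moreover have "orthogonal_visibility_graph m (component ?D v)"
    proof (rule orthogonal_visibility_component[OF _ _ i])
      show "pair_graph ?D" using pg[OF S(1)] symE by (auto simp: pair_graph_iff E_def irrefl_def)
      show "bridging (parcs ?D)"
        using bridging_subset[OF simple_tree_bridging[OF T]] sub'(1) DF sub(2) by simp
      show "disjoint_family_on (\<lambda>v. unit_cube (Suc m) (a S v)) (pverts ?D)" using a(1)[OF S(1)] by simp
    qed (use S in \<open>auto simp: E_def\<close>)
    ultimately show "orthogonal_visibility_graph m (component (D i) v)" by simp
  qed
  moreover have "parcs F = (\<Union>i<Suc m. parcs (D i))"
    unfolding \<T>(3) D_def using ES by auto
  ultimately show ?thesis by (intro exI[of _ D]) (auto simp: D_def)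
qed

text \<open>A component of the union mixes trees of different forests, and an arc may belong to
  several of them. Giving each arc one colour makes the component a coloured tree whose colour
  classes are sets of arcs of the forests \<open>F i\<close>.\<close>

lemma cube_visibility_forest_of_directions:
  fixes F :: "nat \<Rightarrow> 'a pair_pre_digraph"
  assumes T: "simple_tree T"
    and F: "\<And>i. i < Suc m \<Longrightarrow> orthogonal_visibility_forest m (F i)"
      "\<And>i. i < Suc m \<Longrightarrow> pverts (F i) \<subseteq> pverts T" "\<And>i. i < Suc m \<Longrightarrow> parcs (F i) \<subseteq> parcs T"
  shows "cube_visibility_forest (Suc m)
    \<lparr>pverts = \<Union>i<Suc m. pverts (F i), parcs = \<Union>i<Suc m. parcs (F i)\<rparr>" (is "cube_visibility_forest _ ?G")
  unfolding cube_visibility_forest_def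
proof (rule disjoint_union_of_components[OF T])
  have pgT: "pair_graph T" using T by (simp add: simple_tree_def)
  have pgF: "pair_graph (F i)" if "i < Suc m" for i
    using F(1)[OF that] unfolding orthogonal_visibility_forest_def disjoint_union_of_trees_def by blast
  have Fsym: "(v, u) \<in> parcs (F i) \<longleftrightarrow> (u, v) \<in> parcs (F i)" if "i < Suc m" for i u v
    using pgF[OF that] by (auto simp: pair_graph_iff dest: symD)
  show GV: "pverts ?G \<subseteq> pverts T" and GE: "parcs ?G \<subseteq> parcs T" using F(2,3) by auto
  have "parcs ?G \<subseteq> pverts ?G \<times> pverts ?G"
    using pgF by (fastforce simp: pair_graph_iff)
  moreover have "sym (parcs ?G)" using Fsym by (auto intro!: symI)
  moreover have "irrefl (parcs ?G)" using pgT GE by (auto simp: pair_graph_iff irrefl_def)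
  ultimately show pgG: "pair_graph ?G"
    using pgT finite_subset[OF GV] by (auto simp: pair_graph_iff)
  fix x assume x: "x \<in> pverts ?G"
  let ?K = "component ?G x"
  note K = component_pair_graph[OF pgG x]
  have KE: "parcs ?K \<subseteq> parcs ?G" by (auto simp: parcs_component)
  have KT: "parcs ?K \<subseteq> parcs T" using KE GE by blast
  have brT: "bridging (parcs T)" using simple_tree_bridging[OF T] .
  \<comment> \<open>The least index depends only on the edge, so its two opposite arcs get the same
    colour.\<close>
  define c where "c e = (LEAST i. i < Suc m \<and> e \<in> parcs (F i))" for e
  have c: "c e < Suc m \<and> e \<in> parcs (F (c e))" if e: "e \<in> parcs ?K" for e
  proof -
    from e KE have "e \<in> parcs ?G" by blast
    then obtain i where "i < Suc m \<and> e \<in> parcs (F i)" by auto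
    then show ?thesis unfolding c_def by (rule LeastI)
  qed
  have csym: "c (v, u) = c (u, v)" for u v
    unfolding c_def using Fsym by (metis (no_types, lifting))
  let ?R = "colour_class c (parcs ?K)"
  have "\<forall>i. \<exists>h P. i < Suc m \<longrightarrow> (\<forall>u v. u \<noteq> v \<longrightarrow> (u, v) \<in> (?R i)\<^sup>* \<longrightarrow>
    (vis ({..<Suc m} - {i}) h P ((?R i)\<^sup>* `` {u}) u v \<longleftrightarrow> (u, v) \<in> ?R i) \<and>
    (\<forall>q. in_box ({..<Suc m} - {i}) (P u) q \<longrightarrow> in_box ({..<Suc m} - {i}) (P v) q \<longrightarrow> h u \<noteq> (h v :: real)))"
  proof
    fix i
    show "\<exists>h P. i < Suc m \<longrightarrow> (\<forall>u v. u \<noteq> v \<longrightarrow> (u, v) \<in> (?R i)\<^sup>* \<longrightarrow>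
      (vis ({..<Suc m} - {i}) h P ((?R i)\<^sup>* `` {u}) u v \<longleftrightarrow> (u, v) \<in> ?R i) \<and>
      (\<forall>q. in_box ({..<Suc m} - {i}) (P u) q \<longrightarrow> in_box ({..<Suc m} - {i}) (P v) q \<longrightarrow> h u \<noteq> (h v :: real)))"
    proof (cases "i < Suc m")
      case True
      have "?R i \<subseteq> parcs (F i)" using c by (auto simp: colour_class_def)
      moreover have "sym (parcs ?K)" using K(1) by (simp add: pair_graph_iff)
      then have "sym (?R i)" using csym by (auto simp: colour_class_def intro!: symI dest: symD)
      ultimately show ?thesis
        using orthogonal_forest_class_data[OF brT F(3)[OF True] F(1)[OF True] _ _
          bij_betw_transpose_coordinates(2)[OF True]] by blast
    qed simp
  qed
  then obtain h P where hP: "\<And>i u v. i < Suc m \<Longrightarrow> u \<noteq> v \<Longrightarrow> (u, v) \<in> (?R i)\<^sup>* \<Longrightarrow>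
    (vis ({..<Suc m} - {i}) (h i) (P i) ((?R i)\<^sup>* `` {u}) u v \<longleftrightarrow> (u, v) \<in> ?R i) \<and>
    (\<forall>q. in_box ({..<Suc m} - {i}) (P i u) q \<longrightarrow> in_box ({..<Suc m} - {i}) (P i v) q \<longrightarrow> h i u \<noteq> (h i v :: real))"
    by metis
  show "cube_visibility_graph (Suc m) ?K"
  proof (rule cube_visibility_graph_of_colour_classes[where c = c and h = h and P = P])
    show "pair_graph ?K" by fact
    show "bridging (parcs ?K)" using bridging_subset[OF brT KT] .
    show "pverts ?K \<noteq> {}" using K(3) by blast
    show "(u, v) \<in> (parcs ?K)\<^sup>*" if "u \<in> pverts ?K" "v \<in> pverts ?K" for u v
      using component_connected[OF _ that] pgG by (simp add: pair_graph_iff)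
    show "1 \<le> Suc m" by simp
    show "c (u, v) < Suc m \<and> c (v, u) = c (u, v)" if "(u, v) \<in> parcs ?K" for u v
      using c[OF that] csym by simp
    fix i u v assume iuv: "i < Suc m" "u \<noteq> v" "(u, v) \<in> (?R i)\<^sup>*"
    show "vis ({..<Suc m} - {i}) (h i) (P i) ((?R i)\<^sup>* `` {u}) u v \<longleftrightarrow> (u, v) \<in> ?R i"
      using hP[OF iuv] by (rule conjunct1)
    show "h i u \<noteq> h i v"
      if "in_box ({..<Suc m} - {i}) (P i u) q" "in_box ({..<Suc m} - {i}) (P i v) q" for q
      using conjunct2[OF hP[OF iuv]] that by blast
  qed
qed

section \<open>Existence of decompositions\<close>

lemma orthogonal_forest_edge:
  assumes T: "simple_tree T" and e: "(u, v) \<in> parcs T \<or> u = v \<and> u \<in> pverts T"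
  shows "orthogonal_visibility_forest m \<lparr>pverts = {u, v}, parcs = {(u, v), (v, u)} - Id\<rparr>"
    (is "orthogonal_visibility_forest _ ?G")
proof -
  have pgT: "pair_graph T" using T by (simp add: simple_tree_def)
  have uv: "u \<in> pverts T" "v \<in> pverts T" "(u, v) \<in> parcs T \<Longrightarrow> (v, u) \<in> parcs T"
    using e pgT by (auto simp: pair_graph_iff dest: symD)
  have pg: "pair_graph ?G" by (auto simp: pair_graph_iff sym_def irrefl_def)
  have "simple_tree ?G"
  proof (rule simple_tree_connected_subgraph[OF T pg])
    show "pverts ?G \<subseteq> pverts T" "parcs ?G \<subseteq> parcs T" "pverts ?G \<noteq> {}" using uv e by auto
    show "(x, y) \<in> (parcs ?G)\<^sup>*" if "x \<in> pverts ?G" "y \<in> pverts ?G" for x y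
      using that by (cases "x = y") auto
  qed
  moreover have "orthogonal_visibility_graph m ?G"
    unfolding orthogonal_visibility_graph_iff[OF pg]
  \<comment> \<open>\<open>u\<close> sits at height 0 and \<open>v\<close>, if different, straight
    above it at height 1; the line through the common centre \<open>1/2\<close> has nothing in
    between.\<close>
  proof (intro exI[of _ "\<lambda>w j. if j = m \<and> w \<noteq> u then 1 else 0"] conjI ballI)
    let ?a = "\<lambda>w j. if j = m \<and> w \<noteq> u then 1 else (0 :: real)"
    show "disjoint_family_on (\<lambda>v. orthogonal_unit_cube m (?a v)) (pverts ?G)"
      unfolding disjoint_family_on_def orthogonal_unit_cube_eq_slab
      by (auto simp: slab_disjoint_iff)
    fix x y assume xy: "x \<in> pverts ?G" "y \<in> pverts ?G"
    have "vis {..<m} (\<lambda>w. ?a w m) ?a (pverts ?G) x y"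
      unfolding vis_def using xy
      by (intro exI[of _ "\<lambda>_. 1/2"]) (auto simp: in_open_box_def min_def max_def)
    then show "(x, y) \<in> parcs ?G \<longleftrightarrow> x \<noteq> y \<and> vis {..<m} (\<lambda>w. ?a w m) ?a (pverts ?G) x y"
      using xy by auto
  qed
  ultimately show ?thesis
    unfolding orthogonal_visibility_forest_def disjoint_union_of_trees_def using pg
    by (intro conjI exI[of _ "{?G}"]) (auto simp: disjoint_family_on_def)
qed

lemma union_of_subgraphs_iff:
  assumes "pair_graph T" "\<And>H. Q H \<Longrightarrow> pair_graph H"
  shows "union_of_subgraphs Q k T \<longleftrightarrow> (\<exists>H. (\<forall>j<k. Q (H j)) \<and>
    pverts T = (\<Union>j<k. pverts (H j)) \<and> parcs T = (\<Union>j<k. parcs (H j)))"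
  unfolding union_of_subgraphs_def
proof (intro iff_exI)
  fix H :: "nat \<Rightarrow> 'a pair_pre_digraph"
  have "subgraph (with_proj (H j)) (with_proj T) \<longleftrightarrow> pverts (H j) \<subseteq> pverts T \<and> parcs (H j) \<subseteq> parcs T"
    if "Q (H j)" for j
    using pair_graph_subgraph_iff[OF assms(1) assms(2)[OF that]] .
  then show "((\<forall>j<k. subgraph (with_proj (H j)) (with_proj T) \<and> Q (H j)) \<and>
      pverts T = (\<Union>j<k. pverts (H j)) \<and> parcs T = (\<Union>j<k. parcs (H j))) \<longleftrightarrow>
    ((\<forall>j<k. Q (H j)) \<and> pverts T = (\<Union>j<k. pverts (H j)) \<and> parcs T = (\<Union>j<k. parcs (H j)))"
    by auto
qed

lemma forest_pair_graph:
  "orthogonal_visibility_forest m F \<Longrightarrow> pair_graph F"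
  "cube_visibility_forest m F \<Longrightarrow> pair_graph F"
  by (simp_all add: orthogonal_visibility_forest_def cube_visibility_forest_def disjoint_union_of_trees_def)

lemma union_of_forests_iff:
  assumes "simple_tree T"
  shows "union_of_subgraphs (orthogonal_visibility_forest m) k T \<longleftrightarrow>
      (\<exists>H. (\<forall>j<k. orthogonal_visibility_forest m (H j)) \<and>
        pverts T = (\<Union>j<k. pverts (H j)) \<and> parcs T = (\<Union>j<k. parcs (H j)))"
    and "union_of_subgraphs (cube_visibility_forest m) k T \<longleftrightarrow>
      (\<exists>H. (\<forall>j<k. cube_visibility_forest m (H j)) \<and>
        pverts T = (\<Union>j<k. pverts (H j)) \<and> parcs T = (\<Union>j<k. parcs (H j)))"
proof -
  have "pair_graph T" using assms by (simp add: simple_tree_def)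
  note iff = union_of_subgraphs_iff[OF this]
  show "union_of_subgraphs (orthogonal_visibility_forest m) k T \<longleftrightarrow>
      (\<exists>H. (\<forall>j<k. orthogonal_visibility_forest m (H j)) \<and>
        pverts T = (\<Union>j<k. pverts (H j)) \<and> parcs T = (\<Union>j<k. parcs (H j)))"
    by (rule iff) (rule forest_pair_graph(1))
  show "union_of_subgraphs (cube_visibility_forest m) k T \<longleftrightarrow>
      (\<exists>H. (\<forall>j<k. cube_visibility_forest m (H j)) \<and>
        pverts T = (\<Union>j<k. pverts (H j)) \<and> parcs T = (\<Union>j<k. parcs (H j)))"
    by (rule iff) (rule forest_pair_graph(2))
qed

text \<open>Guarantees that the minimum is attained; \<open>LEAST\<close> without a witness would be
  unspecified. The pairs \<open>(v, v)\<close> in \<open>?X\<close> stand for one-vertex trees and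
  cover a tree without arcs.\<close>

lemma union_of_orthogonal_forests_exists:
  fixes T :: "'a pair_pre_digraph"
  assumes T: "simple_tree T"
  shows "\<exists>k. union_of_subgraphs (orthogonal_visibility_forest m) k T"
proof -
  have pgT: "pair_graph T" using T by (simp add: simple_tree_def)
  have V: "finite (pverts T)" "parcs T \<subseteq> pverts T \<times> pverts T" "sym (parcs T)" "irrefl (parcs T)"
    using pgT by (auto simp: pair_graph_iff)
  let ?X = "parcs T \<union> (\<lambda>v. (v, v)) ` pverts T"
  have "finite (parcs T)" using V(1,2) by (meson finite_SigmaI finite_subset)
  then have "finite ?X" using V(1) by simp
  from finite_list[OF this] obtain xs where xs: "set xs = ?X" ..
  define g :: "'a \<times> 'a \<Rightarrow> 'a pair_pre_digraph" where
    "g e = \<lparr>pverts = {fst e, snd e}, parcs = {(fst e, snd e), (snd e, fst e)} - Id\<rparr>" for e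
  have "orthogonal_visibility_forest m (g e)" if "e \<in> ?X" for e
    unfolding g_def using that by (intro orthogonal_forest_edge[OF T]) auto
  then have 1: "\<forall>j<length xs. orthogonal_visibility_forest m (g (xs ! j))"
    using nth_mem xs by blast
  have im: "(\<Union>j<length xs. f (g (xs ! j))) = (\<Union>e\<in>?X. f (g e))" for f :: "'a pair_pre_digraph \<Rightarrow> 'b set"
  proof -
    have "?X = (!) xs ` {..<length xs}" unfolding xs[symmetric] by (auto simp: set_conv_nth)
    then show ?thesis by simp
  qed
  have "pverts T = (\<Union>e\<in>?X. pverts (g e))"
    using V(2) by (auto simp: g_def)
  moreover have "parcs T = (\<Union>e\<in>?X. parcs (g e))"
  proof
    show "parcs T \<subseteq> (\<Union>e\<in>?X. parcs (g e))"
      using V(4) by (force simp: g_def irrefl_def)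
    show "(\<Union>e\<in>?X. parcs (g e)) \<subseteq> parcs T"
      using V(3) by (auto simp: g_def dest: symD)
  qed
  ultimately have "pverts T = (\<Union>j<length xs. pverts (g (xs ! j)))" "parcs T = (\<Union>j<length xs. parcs (g (xs ! j)))"
    using im[of pverts] im[of parcs] by simp_all
  with 1 show ?thesis
    by (intro exI[of _ "length xs"])
      (auto simp: union_of_forests_iff(1)[OF T] intro!: exI[of _ "\<lambda>j. g (xs ! j)"])
qed

section \<open>Grouping forests into blocks, and the ceiling formula\<close>

lemma UN_blocks:
  fixes f :: "nat \<Rightarrow> 'a set"
  assumes "0 < n"
  shows "(\<Union>l<k * n. f l) = (\<Union>j<k. \<Union>i<n. f (j * n + i))"
proof (intro equalityI subsetI)
  fix x assume "x \<in> (\<Union>l<k * n. f l)"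
  then obtain l where l: "l < k * n" "x \<in> f l" by blast
  then have "l div n < k" "l mod n < n" "x \<in> f (l div n * n + l mod n)"
    using assms by (simp_all add: less_mult_imp_div_less)
  then show "x \<in> (\<Union>j<k. \<Union>i<n. f (j * n + i))" by blast
next
  fix x assume "x \<in> (\<Union>j<k. \<Union>i<n. f (j * n + i))"
  then obtain j i where ji: "j < k" "i < n" "x \<in> f (j * n + i)" by blast
  have "j * n + i < Suc j * n" using ji by simp
  also have "\<dots> \<le> k * n" using ji by (intro mult_le_mono1) simp
  finally show "x \<in> (\<Union>l<k * n. f l)" using ji(3) by blast
qed

lemma union_of_orthogonal_forests:
  assumes T: "simple_tree T" and k: "union_of_subgraphs (cube_visibility_forest (Suc m)) k T"
  shows "union_of_subgraphs (orthogonal_visibility_forest m) (k * Suc m) T"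
proof -
  have pgT: "pair_graph T" using T by (simp add: simple_tree_def)
  from k obtain H where "\<forall>j<k. cube_visibility_forest (Suc m) (H j)"
    and VE: "pverts T = (\<Union>j<k. pverts (H j))" "parcs T = (\<Union>j<k. parcs (H j))"
    unfolding union_of_forests_iff(2)[OF T] by (elim exE conjE)
  then have H: "cube_visibility_forest (Suc m) (H j)" if "j < k" for j using that by simp
  have "\<forall>j\<in>{..<k}. \<exists>D. (\<forall>i<Suc m. orthogonal_visibility_forest m (D i) \<and> pverts (D i) = pverts (H j)) \<and>
    parcs (H j) = (\<Union>i<Suc m. parcs (D i))"
  proof
    fix j assume j: "j \<in> {..<k}"
    then have "pverts (H j) \<subseteq> pverts T" "parcs (H j) \<subseteq> parcs T" unfolding VE by blast+
    then show "\<exists>D. (\<forall>i<Suc m. orthogonal_visibility_forest m (D i) \<and> pverts (D i) = pverts (H j)) \<and>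
      parcs (H j) = (\<Union>i<Suc m. parcs (D i))"
      using H j by (intro cube_visibility_forest_directions[OF T]) auto
  qed
  from bchoice[OF this] obtain D where D:
    "\<forall>j\<in>{..<k}. (\<forall>i<Suc m. orthogonal_visibility_forest m (D j i) \<and> pverts (D j i) = pverts (H j)) \<and>
      parcs (H j) = (\<Union>i<Suc m. parcs (D j i))" ..
  \<comment> \<open>Quotient and remainder enumerate the pairs of a cube forest and a
    direction.\<close>
  define H' where "H' l = D (l div Suc m) (l mod Suc m)" for l
  have H': "H' (j * Suc m + i) = D j i" if "i < Suc m" for i j
    using that by (simp add: H'_def del: mult_Suc_right)
  have "\<forall>l<k * Suc m. orthogonal_visibility_forest m (H' l)"
    using D by (simp add: H'_def less_mult_imp_div_less del: mult_Suc_right)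
  moreover have "pverts (H j) = (\<Union>i<Suc m. pverts (H' (j * Suc m + i)))"
    "parcs (H j) = (\<Union>i<Suc m. parcs (H' (j * Suc m + i)))" if "j < k" for j
    using that D by (auto simp add: H' simp del: mult_Suc_right)
  then have "pverts T = (\<Union>l<k * Suc m. pverts (H' l))" "parcs T = (\<Union>l<k * Suc m. parcs (H' l))"
    unfolding VE UN_blocks[of "Suc m", OF zero_less_Suc] by (intro SUP_cong; simp)+
  ultimately show ?thesis
    unfolding union_of_forests_iff(1)[OF T] by blast
qed

lemma union_of_cube_forests:
  fixes T :: "'a pair_pre_digraph"
  assumes T: "simple_tree T" and k: "union_of_subgraphs (orthogonal_visibility_forest m) k T"
    and k': "k \<le> k' * Suc m"
  shows "union_of_subgraphs (cube_visibility_forest (Suc m)) k' T"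
proof -
  have pgT: "pair_graph T" using T by (simp add: simple_tree_def)
  from k obtain H where "\<forall>j<k. orthogonal_visibility_forest m (H j)"
    and VE: "pverts T = (\<Union>j<k. pverts (H j))" "parcs T = (\<Union>j<k. parcs (H j))"
    unfolding union_of_forests_iff(1)[OF T] by (elim exE conjE)
  then have H: "orthogonal_visibility_forest m (H j)" if "j < k" for j using that by simp
  \<comment> \<open>Empty forests pad the family, since \<open>k\<close> may fall short of
    \<open>k' * Suc m\<close>.\<close>
  define F where "F l = (if l < k then H l else \<lparr>pverts = {}, parcs = {}\<rparr>)" for l
  have "orthogonal_visibility_forest m (\<lparr>pverts = {}, parcs = {}\<rparr> :: 'a pair_pre_digraph)"
    unfolding orthogonal_visibility_forest_def disjoint_union_of_trees_def
    by (intro conjI exI[of _ "{}"]) (auto simp: pair_graph_iff disjoint_family_on_def sym_def irrefl_def)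
  then have F: "orthogonal_visibility_forest m (F l)" for l using H by (simp add: F_def)
  have FT: "pverts T = (\<Union>l<k' * Suc m. pverts (F l))" "parcs T = (\<Union>l<k' * Suc m. parcs (F l))"
    unfolding VE F_def using k' by (auto split: if_splits intro: less_le_trans)
  have sub: "pverts (F l) \<subseteq> pverts T" "parcs (F l) \<subseteq> parcs T" for l
    unfolding VE F_def by auto
  \<comment> \<open>Each block of \<open>Suc m\<close> consecutive forests is merged into one cube
    forest; the position in the block is the direction.\<close>
  define G where "G j = \<lparr>pverts = \<Union>i<Suc m. pverts (F (j * Suc m + i)),
    parcs = \<Union>i<Suc m. parcs (F (j * Suc m + i))\<rparr>" for j
  have "cube_visibility_forest (Suc m) (G j)" for j
    unfolding G_def by (rule cube_visibility_forest_of_directions[OF T F sub])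
  moreover have "pverts T = (\<Union>j<k'. pverts (G j))" "parcs T = (\<Union>j<k'. parcs (G j))"
    unfolding FT UN_blocks[of "Suc m", OF zero_less_Suc] G_def by simp_all
  ultimately show ?thesis
    unfolding union_of_forests_iff(2)[OF T] by (intro exI[of _ G]) blast
qed

theorem theorem4:
  fixes n :: nat and T :: "'a pair_pre_digraph"
  assumes "n \<ge> 1" and "simple_tree T"
  shows "int (Upsilon_cube n T) = \<lceil>real (Upsilon_orthogonal (n - 1) T) / real n\<rceil>"
proof -
  obtain m where n: "n = Suc m" using assms(1) by (cases n) auto
  let ?a = "Upsilon_cube n T" and ?b = "Upsilon_orthogonal (n - 1) T"
  have b: "union_of_subgraphs (orthogonal_visibility_forest m) ?b T"
    unfolding Upsilon_orthogonal_def n diff_Suc_1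
    using union_of_orthogonal_forests_exists[OF assms(2)] by (rule LeastI_ex)
  \<comment> \<open>Together with \<open>lower\<close> below, this makes \<open>?a\<close> the least
    \<open>k\<close> with \<open>?b \<le> k * n\<close>.\<close>
  have upper: "?a \<le> k" if "?b \<le> k * n" for k
    using union_of_cube_forests[OF assms(2) b, of k] that
    unfolding Upsilon_cube_def n by (intro Least_le) simp
  \<comment> \<open>A wasteful decomposition that serves to show that the minimum \<open>?a\<close>
    is attained.\<close>
  have "union_of_subgraphs (cube_visibility_forest n) ?b T"
    using union_of_cube_forests[OF assms(2) b, of ?b] by (simp add: n)
  then have "union_of_subgraphs (cube_visibility_forest n) ?a T"
    unfolding Upsilon_cube_def by (rule LeastI)
  then have lower: "?b \<le> ?a * n"
    using union_of_orthogonal_forests[OF assms(2), of m ?a]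
    unfolding Upsilon_orthogonal_def n diff_Suc_1 by (intro Least_le) simp
  have pos: "0 < real n" using assms(1) by simp
  show ?thesis
  proof (rule antisym)
    define k where "k = nat \<lceil>real ?b / real n\<rceil>"
    have "real ?b / real n \<le> real k" unfolding k_def by linarith
    then have "real ?b \<le> real k * real n" using pos by (simp add: pos_divide_le_eq)
    then have "real ?b \<le> real (k * n)" by simp
    then have "?b \<le> k * n" by (simp only: of_nat_le_iff)
    then have "int ?a \<le> int k" using upper by simp
    also have "0 \<le> \<lceil>real ?b / real n\<rceil>"
      using divide_nonneg_pos[OF of_nat_0_le_iff pos, of ?b] by linarith
    then have "int k = \<lceil>real ?b / real n\<rceil>" unfolding k_def by (rule nat_0_le)
    finally show "int ?a \<le> \<lceil>real ?b / real n\<rceil>" .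
    have "real ?b \<le> real ?a * real n" using lower by (simp flip: of_nat_mult)
    then have "real ?b / real n \<le> real ?a" using pos by (simp add: pos_divide_le_eq)
    then show "\<lceil>real ?b / real n\<rceil> \<le> int ?a" by (simp add: ceiling_le_iff)
  qed
qed

end
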